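(* $\mathcal{A}_C^*=\mathcal{EBV}$. That is, the dual of the Banach space $\mathcal{A}_C$ (with the Alexiewicz norm) is identified with $\mathcal{EBV}$ (functions equal almost everywhere being identified) through the pairing $(f,g)\mapsto\int_{-\infty}^\infty fg$: for each $g\in\mathcal{EBV}$ the map $f\mapsto\int_{-\infty}^\infty fg$ is a continuous linear functional on $\mathcal{A}_C$, and each continuous linear functional on $\mathcal{A}_C$ is of this form for a unique $g\in\mathcal{EBV}$.
   Context: $\mathcal{D}=C_c^\infty(\mathbb{R})$ (real-valued), $\mathcal{D}'$ is the space of distributions, $\langle T',\phi\rangle=-\langle T,\phi'\rangle$. $\overline{\mathbb{R}}=[-\infty,\infty]$. $C^0(\overline{\mathbb{R}})$ is the set of continuous real functions $F$ on $\mathbb{R}$ with real limits at $\pm\infty$, extended by $F(\pm\infty)=\lim_{\pm\infty}F$. $\mathcal{B}_C=\{F\in C^0(\overline{\mathbb{R}}): F(-\infty)=0\}$ and $\mathcal{A}_C=\{f\in\mathcal{D}': f=F' \text{ for some } F\in\mathcal{B}_C\}$; the primitive $F\in\mathcal{B}_C$ of $f\in\mathcal{A}_C$ is unique, and the Alexiewicz norm is $\|f\|=\|F\|_\infty$. Functions are identified with distributions in the usual way, so $\mathcal{D}\subset\mathcal{A}_C$, and $\mathcal{D}$ is dense in $\mathcal{A}_C$. For $g\in L^1_{loc}(\mathbb{R})$ the essential variation is $essvar\,g=\sup\int_{-\infty}^\infty g\phi'$, the supremum being over all $\phi\in C_c^1(\mathbb{R})$ with $\|\phi\|_\infty\le 1$;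 $\mathcal{EBV}$ is the set of functions $g$ with $essvar\,g<\infty$. For $f\in\mathcal{A}_C$ and $g\in\mathcal{EBV}$, $\int_{-\infty}^\infty fg:=\lim_{n\to\infty}\int_{-\infty}^\infty\phi_n g$, where $\{\phi_n\}\subset\mathcal{D}$ is any sequence with $\|f-\phi_n\|\to0$ (the limit exists and does not depend on the choice of sequence). *)

theory Defs
  imports "HOL-Analysis.Analysis"
begin

section \<open>Test functions\<close>

definition smooth :: "(real \<Rightarrow> real) \<Rightarrow> bool" where
  "smooth f \<longleftrightarrow> (\<forall>n x. (deriv ^^ n) f differentiable at x)"

lemma smooth_coinduct:
  assumes "P f"
    and step: "\<And>g. P g \<Longrightarrow> \<exists>g'. (\<forall>x. (g has_real_derivative g' x) (at x)) \<and> P g'"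
  shows "smooth f"
proof -
  have "P ((deriv ^^ n) f)" for n
  proof (induction n)
    case (Suc n)
    then obtain g' where g': "\<And>x. ((deriv ^^ n) f has_real_derivative g' x) (at x)" "P g'"
      using step by blast
    then have "deriv ((deriv ^^ n) f) = g'"
      by (auto intro!: DERIV_imp_deriv)
    with g' show ?case by simp
  qed (use assms in auto)
  then show ?thesis
    unfolding smooth_def using step real_differentiable_def by blast
qed

lemma smooth_deriv: "smooth f \<Longrightarrow> smooth (deriv f)"
  unfolding smooth_def by (metis funpow_swap1 funpow_Suc_right o_apply)

lemma smooth_DERIV: "smooth f \<Longrightarrow> (f has_real_derivative deriv f x) (at x)"
  unfolding smooth_def using DERIV_deriv_iff_real_differentiable
  by (metis funpow_0)

lemma smooth_continuous: "smooth f \<Longrightarrow> continuous_on S f"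
  using smooth_DERIV by (meson DERIV_continuous_on has_field_derivative_at_within)

lemma smoothI:
  assumes "\<And>x. (f has_real_derivative f' x) (at x)" "smooth f'"
  shows "smooth f"
  by (rule smooth_coinduct[where P = "\<lambda>g. g = f \<or> smooth g"])
     (use assms smooth_DERIV smooth_deriv in blast)+

lemma smooth_lincomb:
  assumes "smooth f" "smooth g"
  shows "smooth (\<lambda>x. a * f x + b * g x)"
proof (rule smooth_coinduct[where P = "\<lambda>h. \<exists>f g. smooth f \<and> smooth g \<and> h = (\<lambda>x. a * f x + b * g x)"])
  fix h assume "\<exists>f g. smooth f \<and> smooth g \<and> h = (\<lambda>x. a * f x + b * g x)"
  then obtain f g where h: "smooth f" "smooth g" "h = (\<lambda>x. a * f x + b * g x)" by blast
  show "\<exists>h'. (\<forall>x. (h has_real_derivative h' x) (at x)) \<and>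
      (\<exists>f g. smooth f \<and> smooth g \<and> h' = (\<lambda>x. a * f x + b * g x))"
    using h smooth_deriv
    by (intro exI[of _ "\<lambda>x. a * deriv f x + b * deriv g x"])
       (auto intro!: derivative_eq_intros smooth_DERIV)
qed (use assms in blast)

lemma smooth_zero: "smooth (\<lambda>x. 0)"
  by (rule smooth_coinduct[where P = "\<lambda>h. h = (\<lambda>x. 0)"]) auto

inductive prod_span :: "(real \<Rightarrow> real) \<Rightarrow> bool" where
  "smooth g \<Longrightarrow> smooth h \<Longrightarrow> prod_span (\<lambda>x. g x * h x)"
| "prod_span a \<Longrightarrow> prod_span b \<Longrightarrow> prod_span (\<lambda>x. a x + b x)"

lemma smooth_mult:
  assumes "smooth f" "smooth g"
  shows "smooth (\<lambda>x. f x * g x)"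
proof (rule smooth_coinduct[where P = prod_span])
  fix h assume "prod_span h"
  then show "\<exists>h'. (\<forall>x. (h has_real_derivative h' x) (at x)) \<and> prod_span h'"
  proof induction
    case (1 g h)
    have "prod_span (\<lambda>x. deriv g x * h x + g x * deriv h x)"
      using 1 by (intro prod_span.intros smooth_deriv)
    then show ?case
      by (intro exI[of _ "\<lambda>x. deriv g x * h x + g x * deriv h x"])
         (auto intro!: derivative_eq_intros smooth_DERIV 1)
  next
    case (2 a b)
    then obtain a' b' where "\<forall>x. (a has_real_derivative a' x) (at x)" "prod_span a'"
      "\<forall>x. (b has_real_derivative b' x) (at x)" "prod_span b'" by blast
    then show ?case
      by (intro exI[of _ "\<lambda>x. a' x + b' x"]) (auto intro!: derivative_intros prod_span.intros)
  qed
qed (use assms in \<open>auto intro: prod_span.intros\<close>)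

lemma smooth_affine:
  assumes "smooth f"
  shows "smooth (\<lambda>x. f (c + s * x))"
proof (rule smooth_coinduct[where P = "\<lambda>h. \<exists>g k. smooth g \<and> h = (\<lambda>x. k * g (c + s * x))"])
  fix h assume "\<exists>g k. smooth g \<and> h = (\<lambda>x. k * g (c + s * x))"
  then obtain g k where h: "smooth g" "h = (\<lambda>x. k * g (c + s * x))" by blast
  have "((\<lambda>x. g (c + s * x)) has_real_derivative deriv g (c + s * x) * s) (at x)" for x
    by (rule DERIV_chain2[where f = g]) (auto intro!: derivative_eq_intros smooth_DERIV h)
  then have "\<forall>x. (h has_real_derivative (k * s) * deriv g (c + s * x)) (at x)"
    unfolding h by (auto intro!: derivative_eq_intros)
  then show "\<exists>h'. (\<forall>x. (h has_real_derivative h' x) (at x)) \<and>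
      (\<exists>g k. smooth g \<and> h' = (\<lambda>x. k * g (c + s * x)))"
    using smooth_deriv[OF h(1)] by (intro exI[of _ "\<lambda>x. (k * s) * deriv g (c + s * x)"]) blast
qed (use assms in \<open>auto intro!: exI[of _ f] exI[of _ 1]\<close>)

definition flat :: "real poly \<Rightarrow> real \<Rightarrow> real" where
  "flat p x = (if x > 0 then poly p (1 / x) * exp (- (1 / x)) else 0)"


lemma flat_has_derivative:
  "(flat p has_real_derivative flat ([:0, 0, 1:] * (p - pderiv p)) x) (at x)"
proof -
  consider "x > 0" | "x < 0" | "x = 0" by linarith
  then show ?thesis
  proof cases
    case 1
    have "((\<lambda>x. poly p (1 / x) * exp (- (1 / x))) has_real_derivative
        poly (pderiv p) (1 / x) * (- 1 / x\<^sup>2) * exp (- (1 / x))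
        + poly p (1 / x) * (exp (- (1 / x)) * (1 / x\<^sup>2))) (at x)"
    proof -
      have *: "((\<lambda>x. 1 / x) has_real_derivative (- 1 / x\<^sup>2)) (at x)"
        using 1 by (auto intro!: derivative_eq_intros simp: power2_eq_square)
      have "((\<lambda>x. poly p (1 / x)) has_real_derivative poly (pderiv p) (1 / x) * (- 1 / x\<^sup>2)) (at x)"
        by (rule DERIV_chain2[OF poly_DERIV *])
      moreover have "((\<lambda>x. exp (- (1 / x))) has_real_derivative exp (- (1 / x)) * (1 / x\<^sup>2)) (at x)"
        using 1 by (auto intro!: derivative_eq_intros simp: power2_eq_square)
      ultimately show ?thesis
        by (rule DERIV_mult[THEN DERIV_cong]) (simp add: algebra_simps)
    qed
    then have "((\<lambda>x. poly p (1 / x) * exp (- (1 / x))) has_real_derivative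
        flat ([:0, 0, 1:] * (p - pderiv p)) x) (at x)"
      using 1 by (simp add: flat_def algebra_simps power2_eq_square diff_divide_distrib)
    then show ?thesis
      by (rule has_field_derivative_transform_within_open[where S = "{0<..}"])
         (use 1 in \<open>auto simp: flat_def\<close>)
  next
    case 2
    have "((\<lambda>x. 0) has_real_derivative flat ([:0, 0, 1:] * (p - pderiv p)) x) (at x)"
      using 2 by (simp add: flat_def)
    then show ?thesis
      by (rule has_field_derivative_transform_within_open[where S = "{..<0}"])
         (use 2 in \<open>auto simp: flat_def\<close>)
  next
    case 3
    have lim: "((\<lambda>y. poly q y / exp y) \<longlongrightarrow> 0) at_top" for q :: "real poly"
    proof -
      have "((\<lambda>y. \<Sum>i\<le>degree q. coeff q i * (y ^ i / exp y)) \<longlongrightarrow> (\<Sum>i\<le>degree q. coeff q i * 0)) at_top"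
        by (intro tendsto_intros tendsto_power_div_exp_0)
      then show ?thesis
        by (simp add: poly_altdef sum_divide_distrib)
    qed
    have "((\<lambda>h. poly ([:0, 1:] * p) (inverse h) / exp (inverse h)) \<longlongrightarrow> 0) (at_right 0)"
      by (rule filterlim_compose[OF lim filterlim_inverse_at_top_right])
    then have "((\<lambda>h. flat p h / h) \<longlongrightarrow> 0) (at_right 0)"
      by (rule Lim_transform_eventually)
         (auto simp: eventually_at_filter flat_def exp_minus field_simps)
    moreover have "((\<lambda>h. flat p h / h) \<longlongrightarrow> 0) (at_left 0)"
      by (rule Lim_transform_eventually[OF tendsto_const])
         (auto simp: eventually_at_filter flat_def)
    ultimately have "((\<lambda>h. flat p h / h) \<longlongrightarrow> 0) (at 0)"
      by (simp add: filterlim_at_split)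
    with 3 show ?thesis
      by (simp add: DERIV_def flat_def)
  qed
qed

lemma smooth_flat: "smooth (flat p)"
  by (rule smooth_coinduct[where P = "\<lambda>h. \<exists>p. h = flat p"]) (use flat_has_derivative in blast)+

typedef test_fun = "{\<phi> :: real \<Rightarrow> real. smooth \<phi> \<and> compact (closure {x. \<phi> x \<noteq> 0})}"
  morphisms apply_test_fun Abs_test_fun
  by (rule exI[of _ "\<lambda>x. 0"]) (simp add: smooth_zero)

declare [[coercion "apply_test_fun :: test_fun \<Rightarrow> real \<Rightarrow> real"]]

setup_lifting type_definition_test_fun

lemma compact_support_iff:
  "compact (closure {x. f x \<noteq> 0}) \<longleftrightarrow> (\<exists>r. \<forall>x. \<bar>x\<bar> > r \<longrightarrow> f x = 0)" for f :: "real \<Rightarrow> real"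
  unfolding compact_closure bounded_iff by (auto simp: not_le) (meson not_le)+

lemma test_fun_smooth: "smooth (apply_test_fun \<phi>)"
  by transfer simp

lemma test_fun_support: "\<exists>r. \<forall>x. \<bar>x\<bar> > r \<longrightarrow> apply_test_fun \<phi> x = 0"
  by transfer (use compact_support_iff in blast)

lemma compact_support_lincomb:
  fixes f g :: "real \<Rightarrow> real"
  assumes "compact (closure {x. f x \<noteq> 0})" "compact (closure {x. g x \<noteq> 0})"
  shows "compact (closure {x. a * f x + b * g x \<noteq> 0})"
proof -
  obtain r s where "\<forall>x. \<bar>x\<bar> > r \<longrightarrow> f x = 0" "\<forall>x. \<bar>x\<bar> > s \<longrightarrow> g x = 0"
    using assms unfolding compact_support_iff by blast
  then show ?thesis
    unfolding compact_support_iff by (intro exI[of _ "max r s"]) auto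
qed

instantiation test_fun :: real_vector
begin

lift_definition zero_test_fun :: test_fun is "\<lambda>x. 0"
  by (simp add: smooth_zero)

lift_definition plus_test_fun :: "test_fun \<Rightarrow> test_fun \<Rightarrow> test_fun" is "\<lambda>\<phi> \<psi> x. \<phi> x + \<psi> x"
  using smooth_lincomb[of _ _ 1 1] compact_support_lincomb[of _ _ 1 1] by simp

lift_definition minus_test_fun :: "test_fun \<Rightarrow> test_fun \<Rightarrow> test_fun" is "\<lambda>\<phi> \<psi> x. \<phi> x - \<psi> x"
  using smooth_lincomb[of _ _ 1 "-1"] compact_support_lincomb[of _ _ 1 "-1"] by simp

lift_definition uminus_test_fun :: "test_fun \<Rightarrow> test_fun" is "\<lambda>\<phi> x. - \<phi> x"
  using smooth_lincomb[of _ _ "-1" 0] compact_support_lincomb[of _ _ "-1" 0] by force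

lift_definition scaleR_test_fun :: "real \<Rightarrow> test_fun \<Rightarrow> test_fun" is "\<lambda>c \<phi> x. c * \<phi> x"
  using smooth_lincomb[of _ _ _ 0] compact_support_lincomb[of _ _ _ 0] by force

instance
  by standard (transfer; auto simp: fun_eq_iff algebra_simps)+

end

lemma DERIV_locally_zero:
  fixes f :: "real \<Rightarrow> real"
  assumes "open S" "x \<in> S" "\<And>y. y \<in> S \<Longrightarrow> f y = 0"
  shows "(f has_real_derivative 0) (at x)"
proof -
  have "((\<lambda>x. 0) has_real_derivative 0) (at x)" by simp
  then show ?thesis
    by (rule has_field_derivative_transform_within_open) (use assms in auto)
qed

lemma support_deriv_subset:
  fixes f :: "real \<Rightarrow> real"
  shows "closure {x. deriv f x \<noteq> 0} \<subseteq> closure {x. f x \<noteq> 0}"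
proof (rule closure_minimal)
  have "deriv f x = 0" if "x \<in> - closure {x. f x \<noteq> 0}" for x
  proof (rule DERIV_imp_deriv, rule DERIV_locally_zero[OF _ that])
    show "f y = 0" if "y \<in> - closure {x. f x \<noteq> 0}" for y
      using that closure_subset[of "{x. f x \<noteq> 0}"] by auto
  qed auto
  then show "{x. deriv f x \<noteq> 0} \<subseteq> closure {x. f x \<noteq> 0}" by blast
qed simp

lift_definition deriv_test_fun :: "test_fun \<Rightarrow> test_fun" is deriv
proof
  fix f :: "real \<Rightarrow> real"
  assume f: "smooth f \<and> compact (closure {x. f x \<noteq> 0})"
  then show "smooth (deriv f)" by (simp add: smooth_deriv)
  have "bounded (closure {x. deriv f x \<noteq> 0})"
    by (rule bounded_subset[OF _ support_deriv_subset]) (use f in \<open>simp add: compact_imp_bounded\<close>)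
  then show "compact (closure {x. deriv f x \<noteq> 0})"
    by (simp add: compact_eq_bounded_closed)
qed

text \<open>Sequential convergence in the usual inductive limit topology on test functions.\<close>

definition tends_in_D :: "(nat \<Rightarrow> test_fun) \<Rightarrow> test_fun \<Rightarrow> bool" where
  "tends_in_D \<phi> \<psi> \<longleftrightarrow>
    (\<exists>K. compact K \<and> (\<forall>n. closure {x. \<phi> n x \<noteq> 0} \<subseteq> K)) \<and>
    (\<forall>m. uniform_limit UNIV (\<lambda>n. (deriv ^^ m) (\<phi> n)) ((deriv ^^ m) \<psi>) sequentially)"


section \<open>Distributions\<close>

text \<open>For linear functionals on test functions, continuity and sequential continuity agree.\<close>

typedef distribution =
  "{T :: test_fun \<Rightarrow> real. linear T \<and> (\<forall>\<phi> \<psi>. tends_in_D \<phi> \<psi> \<longrightarrow> (\<lambda>n. T (\<phi> n)) \<longlonglongrightarrow> T \<psi>)}"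
  morphisms apply_distribution Abs_distribution
  by (rule exI[of _ "\<lambda>x. 0"]) (simp add: linear_zero)

setup_lifting type_definition_distribution

lemma distribution_eqI:
  "(\<And>\<phi>. apply_distribution S \<phi> = apply_distribution T \<phi>) \<Longrightarrow> S = T"
  by (rule apply_distribution_inject[THEN iffD1], rule ext)

instantiation distribution :: real_vector
begin

lift_definition zero_distribution :: distribution is "\<lambda>\<phi>. 0"
  by (simp add: linear_zero)

lift_definition plus_distribution :: "distribution \<Rightarrow> distribution \<Rightarrow> distribution"
  is "\<lambda>S T \<phi>. S \<phi> + T \<phi>"
  by (auto intro!: linear_compose_add tendsto_add)

lift_definition minus_distribution :: "distribution \<Rightarrow> distribution \<Rightarrow> distribution"
  is "\<lambda>S T \<phi>. S \<phi> - T \<phi>"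
  by (auto intro!: linear_compose_sub tendsto_diff)

lift_definition uminus_distribution :: "distribution \<Rightarrow> distribution" is "\<lambda>T \<phi>. - T \<phi>"
  by (auto intro!: linear_compose_neg tendsto_minus)

lift_definition scaleR_distribution :: "real \<Rightarrow> distribution \<Rightarrow> distribution"
  is "\<lambda>c T \<phi>. c * T \<phi>"
  using linear_compose_scale_right[where 'b = real] by (auto intro!: tendsto_mult_left)

instance
  by standard (transfer; auto simp: fun_eq_iff algebra_simps)+

end

lemma linear_deriv_test_fun: "linear deriv_test_fun"
proof
  fix \<phi> \<psi> :: test_fun and c :: real
  show "deriv_test_fun (\<phi> + \<psi>) = deriv_test_fun \<phi> + deriv_test_fun \<psi>"
    by transfer (auto intro!: ext DERIV_imp_deriv derivative_eq_intros smooth_DERIV)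
  show "deriv_test_fun (c *\<^sub>R \<phi>) = c *\<^sub>R deriv_test_fun \<phi>"
    by transfer (auto intro!: ext DERIV_imp_deriv derivative_eq_intros smooth_DERIV)
qed

lemma tends_in_D_deriv:
  assumes "tends_in_D \<phi> \<psi>"
  shows "tends_in_D (\<lambda>n. deriv_test_fun (\<phi> n)) (deriv_test_fun \<psi>)"
proof -
  obtain K where K: "compact K" "\<And>n. closure {x. \<phi> n x \<noteq> 0} \<subseteq> K"
    using assms unfolding tends_in_D_def by blast
  have "closure {x. deriv_test_fun (\<phi> n) x \<noteq> 0} \<subseteq> K" for n
    using support_deriv_subset[of "\<phi> n"] K(2)[of n] by (auto simp: deriv_test_fun.rep_eq)
  moreover have "uniform_limit UNIV (\<lambda>n. (deriv ^^ m) (deriv_test_fun (\<phi> n)))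
      ((deriv ^^ m) (deriv_test_fun \<psi>)) sequentially" for m
  proof -
    have "uniform_limit UNIV (\<lambda>n. (deriv ^^ Suc m) (\<phi> n)) ((deriv ^^ Suc m) \<psi>) sequentially"
      using assms unfolding tends_in_D_def by blast
    then show ?thesis
      by (simp only: funpow_Suc_right o_apply deriv_test_fun.rep_eq)
  qed
  ultimately show ?thesis
    using K(1) unfolding tends_in_D_def by blast
qed

lift_definition deriv_distribution :: "distribution \<Rightarrow> distribution"
  is "\<lambda>T \<phi>. - T (deriv_test_fun \<phi>)"
  using linear_compose[OF linear_deriv_test_fun]
  by (auto intro!: linear_compose_neg tendsto_minus tends_in_D_deriv simp: o_def)

definition locally_integrable :: "(real \<Rightarrow> real) \<Rightarrow> bool" where
  "locally_integrable g \<longleftrightarrow> (\<forall>K. compact K \<longrightarrow> set_integrable lebesgue K g)"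

lemma borel_measurable_lebesgue_continuous:
  fixes h :: "real \<Rightarrow> real"
  shows "continuous_on UNIV h \<Longrightarrow> h \<in> borel_measurable lebesgue"
  by (intro measurable_completion) (simp add: borel_measurable_continuous_onI)

lemma locally_integrable_mult:
  fixes g h :: "real \<Rightarrow> real"
  assumes g: "locally_integrable g" and h: "continuous_on UNIV h"
    and zero: "\<And>x. \<bar>x\<bar> > r \<Longrightarrow> h x = 0" and bound: "\<And>x. \<bar>h x\<bar> \<le> M"
  shows "integrable lebesgue (\<lambda>x. g x * h x)"
    and "\<bar>LINT x|lebesgue. g x * h x\<bar> \<le> M * (LINT x:{-r..r}|lebesgue. \<bar>g x\<bar>)"
proof -
  have int: "set_integrable lebesgue {-r..r} g"
    using g unfolding locally_integrable_def by simp
  then have int_abs: "integrable lebesgue (\<lambda>x. M * (indicator {-r..r} x * \<bar>g x\<bar>))"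
    using set_integrable_abs[OF int] by (simp add: set_integrable_def)
  have ind: "indicator {-r..r} x = (if \<bar>x\<bar> > r then 0 else 1 :: real)" for x
    by (auto simp: indicator_def)
  have eq: "g x * h x = (indicator {-r..r} x * g x) * h x" for x
    using zero[of x] by (simp add: ind)
  have le: "\<bar>g x * h x\<bar> \<le> M * (indicator {-r..r} x * \<bar>g x\<bar>)" for x
    using zero[of x] mult_right_mono[OF bound[of x], of "\<bar>g x\<bar>"]
    by (simp add: ind abs_mult mult.commute)
  have "(\<lambda>x. indicator {-r..r} x * g x) \<in> borel_measurable lebesgue"
    using int by (auto simp: set_integrable_def dest: borel_measurable_integrable)
  then have meas: "(\<lambda>x. g x * h x) \<in> borel_measurable lebesgue"
    unfolding eq using borel_measurable_lebesgue_continuous[OF h] by measurable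
  show "integrable lebesgue (\<lambda>x. g x * h x)"
    by (rule Bochner_Integration.integrable_bound[OF int_abs meas])
       (auto intro!: AE_I2 order.trans[OF le])
  have "\<bar>LINT x|lebesgue. g x * h x\<bar> \<le> (LINT x|lebesgue. M * (indicator {-r..r} x * \<bar>g x\<bar>))"
    by (rule integral_abs_bound_integral[OF \<open>integrable lebesgue (\<lambda>x. g x * h x)\<close> int_abs])
       (use le in auto)
  then show "\<bar>LINT x|lebesgue. g x * h x\<bar> \<le> M * (LINT x:{-r..r}|lebesgue. \<bar>g x\<bar>)"
    by (simp add: set_lebesgue_integral_def)
qed

lemma bounded_compact_support:
  fixes h :: "real \<Rightarrow> real"
  assumes "continuous_on UNIV h" "\<And>x. \<bar>x\<bar> > r \<Longrightarrow> h x = 0"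
  obtains M where "\<And>x. \<bar>h x\<bar> \<le> M"
proof -
  have "compact (h ` {-r..r})"
    by (intro compact_continuous_image continuous_on_subset[OF assms(1)]) auto
  then obtain M where M: "\<And>x. x \<in> {-r..r} \<Longrightarrow> \<bar>h x\<bar> \<le> M"
    using compact_imp_bounded by (fastforce simp: bounded_iff)
  have "\<bar>h x\<bar> \<le> max M 0" for x
    using M[of x] assms(2)[of x] by (cases "\<bar>x\<bar> > r") (simp, fastforce simp: abs_le_iff)
  then show thesis by (rule that)
qed

lemma test_fun_continuous: "continuous_on S (apply_test_fun \<phi>)"
  by (rule smooth_continuous[OF test_fun_smooth])

lemma integrable_mult_test_fun:
  assumes "locally_integrable g"
  shows "integrable lebesgue (\<lambda>x. g x * apply_test_fun \<phi> x)"
proof -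
  obtain r where r: "\<And>x. \<bar>x\<bar> > r \<Longrightarrow> \<phi> x = 0"
    using test_fun_support by blast
  then obtain M where "\<And>x. \<bar>\<phi> x\<bar> \<le> M"
    using bounded_compact_support test_fun_continuous by blast
  with assms r show ?thesis
    by (intro locally_integrable_mult(1) test_fun_continuous) auto
qed

lemma tendsto_integral_test_fun:
  assumes g: "locally_integrable g" and "tends_in_D \<phi> \<psi>"
  shows "(\<lambda>n. LINT x|lebesgue. g x * \<phi> n x) \<longlonglongrightarrow> (LINT x|lebesgue. g x * \<psi> x)"
proof (rule LIMSEQ_I)
  fix e :: real assume "e > 0"
  obtain K where K: "compact K" "\<And>n. closure {x. \<phi> n x \<noteq> 0} \<subseteq> K"
    using assms unfolding tends_in_D_def by blast
  obtain r where r: "\<And>x. x \<in> K \<Longrightarrow> \<bar>x\<bar> \<le> r"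
    using compact_imp_bounded[OF K(1)] by (auto simp: bounded_iff)
  have zero: "\<phi> n x = 0" if "\<bar>x\<bar> > r" for n x
  proof (rule ccontr)
    assume "\<phi> n x \<noteq> 0"
    then have "x \<in> K"
      using K(2)[of n] closure_subset[of "{x. \<phi> n x \<noteq> 0}"] by auto
    then show False using r that by fastforce
  qed
  have "uniform_limit UNIV (\<lambda>n. (deriv ^^ 0) (\<phi> n)) ((deriv ^^ 0) \<psi>) sequentially"
    using assms unfolding tends_in_D_def by blast
  then have u: "uniform_limit UNIV (\<lambda>n. apply_test_fun (\<phi> n)) \<psi> sequentially"
    by simp
  have zero': "\<psi> x = 0" if "\<bar>x\<bar> > r" for x
  proof -
    have "(\<lambda>n. \<phi> n x) \<longlonglongrightarrow> \<psi> x"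
      by (rule tendsto_uniform_limitI[OF u]) simp
    then show ?thesis
      using zero[OF that] by (simp add: LIMSEQ_const_iff)
  qed
  define C where "C = (LINT x:{-r..r}|lebesgue. \<bar>g x\<bar>)"
  have "C \<ge> 0"
    unfolding C_def set_lebesgue_integral_def by (intro integral_nonneg_AE) auto
  define d where "d = e / (C + 1)"
  have d: "d > 0" "d * C < e"
    using \<open>e > 0\<close> \<open>C \<ge> 0\<close> by (auto simp: d_def field_simps)
  obtain N where N: "\<And>n x. n \<ge> N \<Longrightarrow> \<bar>\<phi> n x - \<psi> x\<bar> < d"
    using uniform_limitD[OF u d(1)] by (auto simp: eventually_sequentially dist_real_def)
  show "\<exists>N. \<forall>n\<ge>N. norm ((LINT x|lebesgue. g x * \<phi> n x) - (LINT x|lebesgue. g x * \<psi> x)) < e"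
  proof (intro exI allI impI)
    fix n assume "n \<ge> N"
    have "(LINT x|lebesgue. g x * \<phi> n x) - (LINT x|lebesgue. g x * \<psi> x) =
        (LINT x|lebesgue. g x * (\<phi> n x - \<psi> x))"
      by (simp add: right_diff_distrib integrable_mult_test_fun[OF g])
    also have "\<bar>\<dots>\<bar> \<le> d * C"
      unfolding C_def using N[OF \<open>n \<ge> N\<close>] zero zero'
      by (intro locally_integrable_mult(2)[OF g] continuous_on_diff test_fun_continuous)
         (auto intro: less_imp_le)
    finally show "norm ((LINT x|lebesgue. g x * \<phi> n x) - (LINT x|lebesgue. g x * \<psi> x)) < e"
      using d by simp
  qed
qed

text \<open>The identification of functions with distributions; the value for functions that are not
  locally integrable is irrelevant.\<close>

lift_definition distribution_of :: "(real \<Rightarrow> real) \<Rightarrow> distribution"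
  is "\<lambda>g (\<phi> :: test_fun). if locally_integrable g then (LINT x|lebesgue. g x * \<phi> x) else 0"
proof -
  fix g
  have "linear (\<lambda>\<phi> :: test_fun. LINT x|lebesgue. g x * \<phi> x)" if g: "locally_integrable g"
  proof
    fix \<phi> \<psi> :: test_fun and c :: real
    show "(LINT x|lebesgue. g x * (\<phi> + \<psi>) x) =
        (LINT x|lebesgue. g x * \<phi> x) + (LINT x|lebesgue. g x * \<psi> x)"
      by (simp add: plus_test_fun.rep_eq distrib_left integrable_mult_test_fun[OF g])
    show "(LINT x|lebesgue. g x * (c *\<^sub>R \<phi>) x) = c *\<^sub>R (LINT x|lebesgue. g x * \<phi> x)"
      by (simp add: scaleR_test_fun.rep_eq mult.left_commute)
  qed
  then show "linear (\<lambda>\<phi> :: test_fun. if locally_integrable g then LINT x|lebesgue. g x * \<phi> x else 0) \<and>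
      (\<forall>\<phi> \<psi>. tends_in_D \<phi> \<psi> \<longrightarrow>
        (\<lambda>n. if locally_integrable g then LINT x|lebesgue. g x * \<phi> n x else 0)
          \<longlonglongrightarrow> (if locally_integrable g then LINT x|lebesgue. g x * \<psi> x else 0))"
    by (cases "locally_integrable g") (auto simp: linear_zero intro: tendsto_integral_test_fun)
qed


section \<open>The space of distributions with continuous primitive\<close>

text \<open>\<open>BC\<close> consists of the continuous functions on the extended real line that vanish at
  \<open>-\<infinity>\<close>, represented by their restrictions to the real line; \<open>ac\<close> is the space of their
  distributional derivatives.\<close>

definition BC :: "(real \<Rightarrow> real) set" where
  "BC = {F. continuous_on UNIV F \<and> (\<exists>l. (F \<longlongrightarrow> l) at_top) \<and> (F \<longlongrightarrow> 0) at_bot}"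

lemma locally_integrable_continuous:
  fixes F :: "real \<Rightarrow> real"
  assumes "continuous_on UNIV F"
  shows "locally_integrable F"
  unfolding locally_integrable_def set_integrable_def
proof (intro allI impI)
  fix K :: "real set" assume "compact K"
  then have int: "integrable lborel (\<lambda>x. indicator K x *\<^sub>R F x)"
    by (intro borel_integrable_compact continuous_on_subset[OF assms]) auto
  show "integrable lebesgue (\<lambda>x. indicator K x *\<^sub>R F x)"
    by (rule integrable_completion[OF borel_measurable_integrable[OF int], THEN iffD2, OF int])
qed

lemma BC_locally_integrable: "F \<in> BC \<Longrightarrow> locally_integrable F"
  by (simp add: BC_def locally_integrable_continuous)

lemma BC_bounded:
  assumes "F \<in> BC"
  obtains M where "\<And>x. \<bar>F x\<bar> \<le> M"
proof -
  obtain l where F: "continuous_on UNIV F" "(F \<longlongrightarrow> l) at_top" "(F \<longlongrightarrow> 0) at_bot"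
    using assms by (auto simp: BC_def)
  obtain b where b: "\<And>x. x \<ge> b \<Longrightarrow> \<bar>F x - l\<bar> < 1"
    using tendstoD[OF F(2), of 1] by (auto simp: eventually_at_top_linorder dist_real_def)
  obtain a where a: "\<And>x. x \<le> a \<Longrightarrow> \<bar>F x\<bar> < 1"
    using tendstoD[OF F(3), of 1] by (auto simp: eventually_at_bot_linorder dist_real_def)
  have "compact (F ` {a..b})"
    by (intro compact_continuous_image continuous_on_subset[OF F(1)]) auto
  then obtain M where M: "\<And>x. x \<in> {a..b} \<Longrightarrow> \<bar>F x\<bar> \<le> M"
    using compact_imp_bounded by (fastforce simp: bounded_iff)
  have "\<bar>F x\<bar> \<le> max M (\<bar>l\<bar> + 1)" for x
    using M[of x] a[of x] b[of x] by (cases "x \<le> a"; cases "x \<ge> b") auto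
  then show thesis by (rule that)
qed

lemma BC_lincomb: "F \<in> BC \<Longrightarrow> G \<in> BC \<Longrightarrow> (\<lambda>x. a * F x + b * G x) \<in> BC"
  unfolding BC_def
  by (auto intro!: continuous_intros tendsto_eq_intros)

lemma zero_in_BC: "(\<lambda>x. 0) \<in> BC"
  by (auto simp: BC_def)

lemma distribution_of_lincomb:
  assumes "locally_integrable f" "locally_integrable g"
  shows "distribution_of (\<lambda>x. a * f x + b * g x) = a *\<^sub>R distribution_of f + b *\<^sub>R distribution_of g"
proof -
  have "set_integrable lebesgue K (\<lambda>x. a * f x + b * g x)" if "compact K" for K
    using assms that unfolding locally_integrable_def
    by (intro set_integral_add set_integrable_mult_right) auto
  then have "locally_integrable (\<lambda>x. a * f x + b * g x)"
    by (simp add: locally_integrable_def)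
  then show ?thesis
    by (intro distribution_eqI)
      (simp add: distribution_of.rep_eq assms plus_distribution.rep_eq scaleR_distribution.rep_eq
        distrib_right mult.assoc integrable_mult_test_fun[OF assms(1)] integrable_mult_test_fun[OF assms(2)])
qed

lemma deriv_distribution_lincomb:
  "deriv_distribution (a *\<^sub>R S + b *\<^sub>R T) = a *\<^sub>R deriv_distribution S + b *\<^sub>R deriv_distribution T"
  by (rule distribution_eqI)
    (simp add: deriv_distribution.rep_eq plus_distribution.rep_eq scaleR_distribution.rep_eq)

lemma antiderivative_compact_support:
  fixes h :: "real \<Rightarrow> real"
  assumes h: "continuous_on UNIV h" "\<And>x. \<bar>x\<bar> > r \<Longrightarrow> h x = 0"
  obtains H c where "\<And>x. (H has_real_derivative h x) (at x)"
    "\<And>x. x < - r \<Longrightarrow> H x = 0" "\<And>x. x > r \<Longrightarrow> H x = c"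
proof -
  have "continuous_on {a..b} h" for a b
    by (rule continuous_on_subset[OF h(1)]) auto
  then have "\<exists>F. \<forall>x. (F has_vector_derivative h x) (at x)"
    using einterval_antiderivative[of "-\<infinity>" "\<infinity>" h] h(1)
    by (auto simp: continuous_on_eq_continuous_at)
  then obtain F where F: "\<And>x. (F has_real_derivative h x) (at x)"
    by (auto simp: has_real_derivative_iff_has_vector_derivative)
  have const: "\<exists>c. \<forall>x\<in>S. F x = c" if "convex S" "\<And>x. x \<in> S \<Longrightarrow> \<bar>x\<bar> > r" for S
  proof (rule has_field_derivative_zero_constant[OF that(1)])
    show "(F has_field_derivative 0) (at x within S)" if "x \<in> S" for x
      using has_field_derivative_at_within[OF F, of x S] h(2) \<open>\<And>x. x \<in> S \<Longrightarrow> \<bar>x\<bar> > r\<close> that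
      by simp
  qed
  obtain c1 where c1: "\<And>x. x < - r \<Longrightarrow> F x = c1"
    using const[of "{..<-r}"] by fastforce
  obtain c2 where c2: "\<And>x. x > r \<Longrightarrow> F x = c2"
    using const[of "{r<..}"] by fastforce
  show thesis
    by (rule that[of "\<lambda>x. F x - c1" "c2 - c1"])
       (auto intro!: derivative_eq_intros F simp: c1 c2)
qed

lemma integral_derivative_compact_support:
  fixes f :: "real \<Rightarrow> real"
  assumes f: "\<And>x. (f has_real_derivative f' x) (at x)" and cont: "continuous_on UNIV f'"
    and zero: "\<And>x. \<bar>x\<bar> > r \<Longrightarrow> f x = 0"
  shows "(LINT x|lebesgue. f' x) = 0"
proof -
  define R where "R = \<bar>r\<bar> + 1"
  have R: "R > r" "R > 0" by (auto simp: R_def)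
  have "f' x = 0" if "\<bar>x\<bar> > r" for x
  proof (rule DERIV_unique[OF f])
    show "(f has_real_derivative 0) (at x)"
      by (rule DERIV_locally_zero[of "{x. \<bar>x\<bar> > r}"])
         (use that zero in \<open>auto intro!: open_Collect_less continuous_intros\<close>)
  qed
  then have eq: "f' x * indicator {-R..R} x = f' x" for x
    using R by (cases "\<bar>x\<bar> > r") (auto simp: indicator_def)
  have "(LINT x|lborel. f' x * indicator {-R..R} x) = f R - f (- R)"
    using R f cont by (intro integral_FTC_Icc_real) (auto simp: continuous_on_eq_continuous_at)
  moreover have "f R = 0" "f (- R) = 0"
    using R zero[of R] zero[of "- R"] by auto
  ultimately have "(LINT x|lborel. f' x) = 0"
    unfolding eq by simp
  then show ?thesis
    by (subst integral_completion) (use cont in \<open>auto intro: borel_measurable_continuous_onI\<close>)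
qed

lemma BC_zero_if_integrals_zero:
  assumes F: "F \<in> BC"
    and zero: "\<And>\<rho> :: test_fun. (LINT x|lebesgue. F x * \<rho> x) = 0"
  shows "F a = 0"
proof (rule ccontr)
  assume "F a \<noteq> 0"
  have contF: "continuous_on UNIV F" using F by (simp add: BC_def)
  then have contFF: "continuous_on UNIV (\<lambda>x. F a * F x)" by (intro continuous_intros)
  have "open ((\<lambda>x. F a * F x) -` {0<..})"
    by (rule open_vimage[OF _ contFF]) auto
  moreover have "a \<in> (\<lambda>x. F a * F x) -` {0<..}"
    using \<open>F a \<noteq> 0\<close> by (simp add: zero_less_mult_iff linorder_neq_iff disj_commute)
  ultimately obtain d where d: "d > 0" "ball a d \<subseteq> (\<lambda>x. F a * F x) -` {0<..}"
    by (meson open_contains_ball)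
  define \<rho> where "\<rho> x = flat 1 (- (a - d) + 1 * x) * flat 1 ((a + d) + (- 1) * x)" for x
  have \<rho>0: "\<rho> x = 0" if "x \<notin> ball a d" for x
    using that by (auto simp: \<rho>_def flat_def dist_real_def)
  have \<rho>1: "\<rho> x > 0" if "x \<in> ball a d" for x
    using that by (auto simp: \<rho>_def flat_def dist_real_def)
  have "smooth \<rho>"
    unfolding \<rho>_def by (intro smooth_mult smooth_affine smooth_flat)
  moreover have "bounded {x. \<rho> x \<noteq> 0}"
    by (rule bounded_subset[OF bounded_ball[of a d]]) (use \<rho>0 in blast)
  ultimately have ap: "apply_test_fun (Abs_test_fun \<rho>) = \<rho>"
    by (simp add: Abs_test_fun_inverse)
  define h where "h x = F a * F x * \<rho> x" for x
  have h0: "h x \<ge> 0" for x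
    using d(2) \<rho>0[of x] \<rho>1[of x] by (cases "x \<in> ball a d") (auto simp: h_def less_imp_le subset_iff)
  have int: "integrable lebesgue (\<lambda>x. F x * \<rho> x)"
    using integrable_mult_test_fun[OF BC_locally_integrable[OF F], of "Abs_test_fun \<rho>"] ap by simp
  have h_eq: "h = (\<lambda>x. F a * (F x * \<rho> x))"
    by (simp add: h_def fun_eq_iff mult.assoc)
  have "integrable lebesgue h" "(LINT x|lebesgue. h x) = 0"
    using zero[of "Abs_test_fun \<rho>"] ap int by (auto simp: h_eq)
  then have "AE x in lebesgue. h x = 0"
    using integral_nonneg_eq_0_iff_AE[of lebesgue h] h0 by auto
  moreover have "continuous_on UNIV h"
    unfolding h_def by (intro continuous_intros contF smooth_continuous \<open>smooth \<rho>\<close>)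
  then have "closed (h -` {0})"
    by (intro closed_vimage) auto
  ultimately have "a \<in> h -` {0}"
    by (intro mem_closed_if_AE_lebesgue[of "h -` {0}"]) auto
  then show False
    using \<open>F a \<noteq> 0\<close> \<rho>1[of a] d(1) by (simp add: h_def)
qed

lemma BC_zero_if_derivative_zero:
  assumes F: "F \<in> BC"
    and zero: "\<And>\<phi>. (LINT x|lebesgue. F x * deriv_test_fun \<phi> x) = 0"
  shows "F a = 0"
proof (rule BC_zero_if_integrals_zero[OF F])
  fix \<rho> :: test_fun
  obtain r where r: "\<And>x. \<bar>x\<bar> > r \<Longrightarrow> \<rho> x = 0"
    using test_fun_support by blast
  obtain H c where H: "\<And>x. (H has_real_derivative \<rho> x) (at x)"
      "\<And>x. x < - r \<Longrightarrow> H x = 0" "\<And>x. x > r \<Longrightarrow> H x = c"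
    using antiderivative_compact_support[OF test_fun_continuous r] by blast
  have shift: "(LINT x|lebesgue. F x * \<rho> x) = (LINT x|lebesgue. F (x - real n) * \<rho> x)" for n
  proof -
    define \<phi> where "\<phi> x = H x - H (real n + 1 * x)" for x
    have "smooth H"
      by (rule smoothI[OF H(1) test_fun_smooth])
    then have "smooth \<phi>"
      unfolding \<phi>_def
      using smooth_lincomb[of H "\<lambda>x. H (real n + 1 * x)" 1 "-1"] smooth_affine[of H "real n" 1]
      by simp
    have "\<phi> x = 0" if "\<bar>x\<bar> > \<bar>r\<bar> + real n" for x
      using that H(2)[of x] H(2)[of "real n + x"] H(3)[of x] H(3)[of "real n + x"]
      by (cases "x > 0") (auto simp: \<phi>_def)
    then have supp: "compact (closure {x. \<phi> x \<noteq> 0})"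
      unfolding compact_support_iff by blast
    have "deriv \<phi> x = \<rho> x - \<rho> (real n + x)" for x
    proof (rule DERIV_imp_deriv)
      have "((\<lambda>x. H (real n + 1 * x)) has_real_derivative \<rho> (real n + 1 * x) * 1) (at x)"
        by (rule DERIV_chain2[OF H(1)]) (auto intro!: derivative_eq_intros)
      then show "(\<phi> has_real_derivative \<rho> x - \<rho> (real n + x)) (at x)"
        unfolding \<phi>_def by (auto intro!: derivative_eq_intros H(1))
    qed
    then have d: "apply_test_fun (deriv_test_fun (Abs_test_fun \<phi>)) = (\<lambda>x. \<rho> x - \<rho> (real n + x))"
      using \<open>smooth \<phi>\<close> supp
      by (simp add: deriv_test_fun.rep_eq Abs_test_fun_inverse fun_eq_iff del: compact_closure)
    have "\<exists>s. \<forall>x. \<bar>x\<bar> > s \<longrightarrow> \<rho> (real n + 1 * x) = 0"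
      by (rule exI[of _ "\<bar>r\<bar> + real n"]) (auto intro!: r)
    then have supp': "compact (closure {x. \<rho> (real n + 1 * x) \<noteq> 0})"
      unfolding compact_support_iff by blast
    have int2: "integrable lebesgue (\<lambda>x. F x * \<rho> (real n + 1 * x))"
      using integrable_mult_test_fun[OF BC_locally_integrable[OF F],
          of "Abs_test_fun (\<lambda>x. \<rho> (real n + 1 * x))"]
        supp' smooth_affine[OF test_fun_smooth, of \<rho> "real n" 1]
      by (simp add: Abs_test_fun_inverse del: compact_closure)
    have "(LINT x|lebesgue. F x * \<rho> x) - (LINT x|lebesgue. F x * \<rho> (real n + 1 * x)) = 0"
      using zero[of "Abs_test_fun \<phi>"] int2 integrable_mult_test_fun[OF BC_locally_integrable[OF F], of \<rho>]
      by (simp add: d right_diff_distrib)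
    moreover have "(LINT x|lebesgue. F (x - real n) * \<rho> x) = (LINT x|lebesgue. F x * \<rho> (real n + 1 * x))"
      using lebesgue_integral_real_affine[of 1 "\<lambda>x. F (x - real n) * \<rho> x" "real n"] by simp
    ultimately show ?thesis by simp
  qed
  obtain M where M: "\<And>x. \<bar>F x\<bar> \<le> M"
    using BC_bounded[OF F] by blast
  have contF: "continuous_on UNIV F" using F by (simp add: BC_def)
  have int\<rho>: "integrable lebesgue \<rho>"
    using integrable_mult_test_fun[OF locally_integrable_continuous[OF continuous_on_const[of UNIV 1]], of \<rho>]
    by simp
  have "(\<lambda>n. LINT x|lebesgue. F (x - real n) * \<rho> x) \<longlonglongrightarrow> integral\<^sup>L lebesgue (\<lambda>x :: real. 0 :: real)"
  proof (rule integral_dominated_convergence)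
    show "integrable lebesgue (\<lambda>x. M * \<bar>\<rho> x\<bar>)"
      using int\<rho> by auto
    show "(\<lambda>x. F (x - real n) * \<rho> x) \<in> borel_measurable lebesgue" for n
      by (intro borel_measurable_lebesgue_continuous continuous_intros test_fun_continuous
          continuous_on_compose2[OF contF]) auto
    have "(\<lambda>n. F (x - real n) * \<rho> x) \<longlonglongrightarrow> 0" for x
    proof -
      have "filterlim (\<lambda>n. - x + real n) at_top sequentially"
        by (rule filterlim_tendsto_add_at_top[OF tendsto_const filterlim_real_sequentially])
      then have "filterlim (\<lambda>n. x + - real n) at_bot sequentially"
        by (simp add: filterlim_uminus_at_top)
      then have "(\<lambda>n. F (x + - real n)) \<longlonglongrightarrow> 0"
        using F by (auto simp: BC_def intro: filterlim_compose)
      then show ?thesis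
        by (auto intro: tendsto_mult_left_zero)
    qed
    then show "AE x in lebesgue. (\<lambda>n. F (x - real n) * \<rho> x) \<longlonglongrightarrow> 0" by simp
    show "AE x in lebesgue. norm (F (x - real n) * \<rho> x) \<le> M * \<bar>\<rho> x\<bar>" for n
      using M by (auto simp: abs_mult intro!: AE_I2 mult_right_mono)
  qed auto
  then show "(LINT x|lebesgue. F x * \<rho> x) = 0"
    unfolding shift[symmetric] by (simp add: LIMSEQ_const_iff)
qed

typedef ac = "{f. \<exists>F\<in>BC. f = deriv_distribution (distribution_of F)}"
  morphisms distribution_of_ac Abs_ac
  using zero_in_BC by blast

setup_lifting type_definition_ac

lemma ac_lincomb_mem:
  assumes "F \<in> BC" "G \<in> BC"
  shows "a *\<^sub>R deriv_distribution (distribution_of F) + b *\<^sub>R deriv_distribution (distribution_of G) =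
    deriv_distribution (distribution_of (\<lambda>x. a * F x + b * G x))"
  using assms by (simp add: distribution_of_lincomb deriv_distribution_lincomb BC_locally_integrable)

lemma ac_lincomb:
  assumes "\<exists>F\<in>BC. f = deriv_distribution (distribution_of F)"
    "\<exists>G\<in>BC. g = deriv_distribution (distribution_of G)"
  shows "\<exists>F\<in>BC. a *\<^sub>R f + b *\<^sub>R g = deriv_distribution (distribution_of F)"
  using assms ac_lincomb_mem BC_lincomb by metis

instantiation ac :: real_vector
begin

lift_definition zero_ac :: ac is 0
proof -
  have "\<exists>F\<in>BC. 0 *\<^sub>R T + 0 *\<^sub>R T = deriv_distribution (distribution_of F)"
    if "T = deriv_distribution (distribution_of (\<lambda>x. 0))" for T
    using that zero_in_BC by (intro ac_lincomb) blast+
  then show "\<exists>F\<in>BC. 0 = deriv_distribution (distribution_of F)" by simp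
qed

lift_definition plus_ac :: "ac \<Rightarrow> ac \<Rightarrow> ac" is "\<lambda>f g. f + g"
  using ac_lincomb[of _ _ 1 1] by simp

lift_definition minus_ac :: "ac \<Rightarrow> ac \<Rightarrow> ac" is "\<lambda>f g. f - g"
  using ac_lincomb[of _ _ 1 "-1"] by simp

lift_definition uminus_ac :: "ac \<Rightarrow> ac" is "\<lambda>f. - f"
  using ac_lincomb[of _ _ "-1" 0] by force

lift_definition scaleR_ac :: "real \<Rightarrow> ac \<Rightarrow> ac" is "\<lambda>c f. c *\<^sub>R f"
  using ac_lincomb[of _ _ _ 0] by force

instance
  by standard (transfer; simp add: algebra_simps)+

end

definition primitive :: "ac \<Rightarrow> real \<Rightarrow> real" where
  "primitive f = (THE F. F \<in> BC \<and> distribution_of_ac f = deriv_distribution (distribution_of F))"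

lemma primitive_unique:
  assumes F: "F \<in> BC" and G: "G \<in> BC"
    and eq: "deriv_distribution (distribution_of F) = deriv_distribution (distribution_of G)"
  shows "F = G"
proof
  fix a
  define H where "H x = 1 * F x + (-1) * G x" for x
  have H: "H \<in> BC"
    unfolding H_def by (rule BC_lincomb[OF F G])
  have "deriv_distribution (distribution_of H) = 0"
    unfolding H_def using ac_lincomb_mem[OF F G, of 1 "-1"] eq by simp
  then have "apply_distribution (deriv_distribution (distribution_of H)) \<phi> = 0" for \<phi>
    by (simp add: zero_distribution.rep_eq)
  then have "(LINT x|lebesgue. H x * deriv_test_fun \<phi> x) = 0" for \<phi>
    by (simp add: deriv_distribution.rep_eq distribution_of.rep_eq BC_locally_integrable[OF H])
  then have "H a = 0"
    by (rule BC_zero_if_derivative_zero[OF H])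
  then show "F a = G a" by (simp add: H_def)
qed

lemma primitive_eqI:
  "F \<in> BC \<Longrightarrow> distribution_of_ac f = deriv_distribution (distribution_of F) \<Longrightarrow> primitive f = F"
  unfolding primitive_def by (rule the_equality) (auto dest: primitive_unique)

lemma primitive_in_BC: "primitive f \<in> BC"
  and distribution_of_ac_primitive:
    "distribution_of_ac f = deriv_distribution (distribution_of (primitive f))"
proof -
  obtain F where F: "F \<in> BC" "distribution_of_ac f = deriv_distribution (distribution_of F)"
    using distribution_of_ac[of f] by blast
  then show "primitive f \<in> BC"
    "distribution_of_ac f = deriv_distribution (distribution_of (primitive f))"
    using primitive_eqI[OF F] by auto
qed

lemma primitive_lincomb: "primitive (a *\<^sub>R f + b *\<^sub>R g) = (\<lambda>x. a * primitive f x + b * primitive g x)"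
  by (rule primitive_eqI[OF BC_lincomb[OF primitive_in_BC primitive_in_BC]])
     (simp add: plus_ac.rep_eq scaleR_ac.rep_eq distribution_of_ac_primitive[of f]
        distribution_of_ac_primitive[of g] ac_lincomb_mem[OF primitive_in_BC primitive_in_BC])

lemma primitive_add: "primitive (f + g) x = primitive f x + primitive g x"
  using primitive_lincomb[of 1 f 1 g] by simp

lemma primitive_diff: "primitive (f - g) x = primitive f x - primitive g x"
  using primitive_lincomb[of 1 f "-1" g] by simp

lemma primitive_scaleR: "primitive (c *\<^sub>R f) x = c * primitive f x"
  using primitive_lincomb[of c f 0 f] by simp

lemma primitive_surj:
  assumes "F \<in> BC"
  obtains f where "primitive f = F"
  using primitive_eqI[OF assms, of "Abs_ac (deriv_distribution (distribution_of F))"] assms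
  by (metis (mono_tags, lifting) Abs_ac_inverse mem_Collect_eq)

lemma primitive_inject: "primitive f = primitive g \<Longrightarrow> f = g"
  using distribution_of_ac_primitive distribution_of_ac_inject by metis

lemma bdd_above_primitive: "bdd_above (range (\<lambda>x. \<bar>primitive f x\<bar>))"
  using BC_bounded[OF primitive_in_BC[of f]] by (auto simp: bdd_above_def)

instantiation ac :: real_normed_vector
begin

text \<open>The Alexiewicz norm: by continuity the supremum over the extended line equals the
  supremum over the real line.\<close>

definition norm_ac :: "ac \<Rightarrow> real" where
  "norm_ac f = (SUP x. \<bar>primitive f x\<bar>)"

definition dist_ac :: "ac \<Rightarrow> ac \<Rightarrow> real" where
  "dist_ac f g = norm (f - g)"

definition sgn_ac :: "ac \<Rightarrow> ac" where
  "sgn_ac f = f /\<^sub>R norm f"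

definition uniformity_ac :: "(ac \<times> ac) filter" where
  "uniformity_ac = (INF e\<in>{0<..}. principal {(f, g). dist f g < e})"

definition open_ac :: "ac set \<Rightarrow> bool" where
  "open_ac U = (\<forall>f\<in>U. eventually (\<lambda>(f', g). f' = f \<longrightarrow> g \<in> U) uniformity)"

lemma primitive_le_norm: "\<bar>primitive f x\<bar> \<le> norm f"
  unfolding norm_ac_def by (rule cSUP_upper[OF _ bdd_above_primitive]) simp

lemma norm_ac_leI: "(\<And>x. \<bar>primitive f x\<bar> \<le> M) \<Longrightarrow> norm f \<le> M"
  unfolding norm_ac_def by (rule cSUP_least) auto

instance
proof
  fix f g :: ac and c :: real
  have le_scale: "norm (c *\<^sub>R f) \<le> \<bar>c\<bar> * norm f" for c and f :: ac
    by (rule norm_ac_leI)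
       (simp add: primitive_scaleR abs_mult mult_left_mono primitive_le_norm)
  show "norm (f + g) \<le> norm f + norm g"
  proof (rule norm_ac_leI)
    show "\<bar>primitive (f + g) x\<bar> \<le> norm f + norm g" for x
      using primitive_le_norm[of f x] primitive_le_norm[of g x] by (simp add: primitive_add)
  qed
  show "norm (c *\<^sub>R f) = \<bar>c\<bar> * norm f"
  proof (cases "c = 0")
    case True
    then show ?thesis
      using le_scale[of c f] primitive_le_norm[of "c *\<^sub>R f" 0] by simp
  next
    case False
    then show ?thesis
      using le_scale[of c f] le_scale[of "inverse c" "c *\<^sub>R f"] by (simp add: field_simps)
  qed
  show "norm f = 0 \<longleftrightarrow> f = 0"
  proof
    assume "norm f = 0"
    then have "primitive f x = primitive (0 *\<^sub>R f) x" for x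
      using primitive_le_norm[of f x] by (simp only: primitive_scaleR)
    then show "f = 0"
      using primitive_inject[of f "0 *\<^sub>R f"] by auto
  next
    assume "f = 0"
    then show "norm f = 0"
      using le_scale[of 0 f] primitive_le_norm[of f 0] by simp
  qed
qed (simp_all add: dist_ac_def sgn_ac_def uniformity_ac_def open_ac_def)

end

instance ac :: banach
proof
  fix f :: "nat \<Rightarrow> ac" assume "Cauchy f"
  have le: "dist (primitive (f m) x) (primitive (f n) x) \<le> dist (f m) (f n)" for m n x
    using primitive_le_norm[of "f m - f n" x] by (simp add: primitive_diff dist_norm)
  have "uniformly_Cauchy_on UNIV (\<lambda>n. primitive (f n))"
    unfolding uniformly_Cauchy_on_def
    using metric_CauchyD[OF \<open>Cauchy f\<close>] le by (meson le_less_trans)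
  then obtain F where F: "uniform_limit UNIV (\<lambda>n. primitive (f n)) F sequentially"
    using Cauchy_uniformly_convergent uniformly_convergent_on_def by blast
  have BC: "continuous_on UNIV (primitive (f n))" "\<exists>l. (primitive (f n) \<longlongrightarrow> l) at_top"
    "(primitive (f n) \<longlongrightarrow> 0) at_bot" for n
    using primitive_in_BC[of "f n"] by (auto simp: BC_def)
  then obtain l where l: "\<And>n. (primitive (f n) \<longlongrightarrow> l n) at_top"
    by metis
  have "Cauchy l"
  proof (rule metric_CauchyI)
    fix e :: real assume "e > 0"
    then obtain N where N: "\<And>m n. m \<ge> N \<Longrightarrow> n \<ge> N \<Longrightarrow> dist (f m) (f n) < e / 2"
      using metric_CauchyD[OF \<open>Cauchy f\<close>, of "e / 2"] by auto
    have "dist (l m) (l n) < e" if "m \<ge> N" "n \<ge> N" for m n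
    proof -
      have "dist (l m) (l n) \<le> e / 2"
      proof (rule tendsto_upperbound[OF tendsto_dist[OF l l]])
        have "dist (primitive (f m) x) (primitive (f n) x) \<le> e / 2" for x
          using le[of m x n] N[OF that] by linarith
        then show "\<forall>\<^sub>F x in at_top. dist (primitive (f m) x) (primitive (f n) x) \<le> e / 2"
          by simp
      qed simp
      with \<open>e > 0\<close> show ?thesis by simp
    qed
    then show "\<exists>N. \<forall>m\<ge>N. \<forall>n\<ge>N. dist (l m) (l n) < e" by blast
  qed
  then obtain L where L: "l \<longlonglongrightarrow> L"
    using Cauchy_convergent_iff convergent_def by blast
  have "continuous_on UNIV F"
    by (rule uniform_limit_theorem[OF _ F]) (auto simp: BC)
  moreover have "(F \<longlongrightarrow> L) at_top"
    by (rule swap_uniform_limit'[OF _ L F]) (auto simp: l)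
  moreover have "(F \<longlongrightarrow> 0) at_bot"
    by (rule swap_uniform_limit'[OF _ tendsto_const F]) (auto simp: BC)
  ultimately have "F \<in> BC"
    by (auto simp: BC_def)
  then obtain g where g: "primitive g = F"
    by (rule primitive_surj)
  have "f \<longlonglongrightarrow> g"
  proof (rule metric_LIMSEQ_I)
    fix e :: real assume "e > 0"
    then obtain N where N: "\<And>n x. n \<ge> N \<Longrightarrow> dist (primitive (f n) x) (F x) < e / 2"
      using uniform_limitD[OF F, of "e / 2"] by (auto simp: eventually_sequentially)
    have "dist (f n) g < e" if "n \<ge> N" for n
    proof -
      have "norm (f n - g) \<le> e / 2"
        by (rule norm_ac_leI) (use N[OF that] in \<open>auto simp: primitive_diff g dist_real_def less_imp_le\<close>)
      with \<open>e > 0\<close> show ?thesis by (simp add: dist_norm)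
    qed
    then show "\<exists>N. \<forall>n\<ge>N. dist (f n) g < e" by blast
  qed
  then show "convergent f"
    by (auto simp: convergent_def)
qed

lemma distribution_of_test_fun_primitive:
  fixes \<phi> :: test_fun
  shows "\<exists>F\<in>BC. distribution_of \<phi> = deriv_distribution (distribution_of F)"
proof -
  obtain r where r: "\<And>x. \<bar>x\<bar> > r \<Longrightarrow> \<phi> x = 0"
    using test_fun_support by blast
  obtain H c where H: "\<And>x. (H has_real_derivative \<phi> x) (at x)"
      "\<And>x. x < - r \<Longrightarrow> H x = 0" "\<And>x. x > r \<Longrightarrow> H x = c"
    using antiderivative_compact_support[OF test_fun_continuous r] by blast
  have contH: "continuous_on UNIV H"
    using H(1) by (meson DERIV_continuous_on has_field_derivative_at_within)
  have "(H \<longlongrightarrow> c) at_top"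
    by (rule tendsto_eventually, rule eventually_mono[OF eventually_gt_at_top[of r]]) (rule H(3))
  moreover have "(H \<longlongrightarrow> 0) at_bot"
    by (rule tendsto_eventually, rule eventually_mono[OF eventually_gt_at_bot[of "- r"]]) (rule H(2))
  ultimately have "H \<in> BC"
    using contH by (auto simp: BC_def)
  moreover have "distribution_of \<phi> = deriv_distribution (distribution_of H)"
  proof -
    have lH: "locally_integrable H" and l\<phi>: "locally_integrable \<phi>"
      by (auto intro: locally_integrable_continuous contH test_fun_continuous)
    have "(LINT x|lebesgue. \<phi> x * \<psi> x) = - (LINT x|lebesgue. H x * deriv_test_fun \<psi> x)"
      for \<psi> :: test_fun
    proof -
      obtain s where s: "\<And>x. \<bar>x\<bar> > s \<Longrightarrow> \<psi> x = 0"
        using test_fun_support by blast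
      have "(LINT x|lebesgue. H x * deriv_test_fun \<psi> x + \<phi> x * \<psi> x) = 0"
      proof (rule integral_derivative_compact_support)
        show "((\<lambda>x. H x * \<psi> x) has_real_derivative H x * deriv_test_fun \<psi> x + \<phi> x * \<psi> x) (at x)" for x
          by (rule DERIV_mult[OF H(1) smooth_DERIV[OF test_fun_smooth], THEN DERIV_cong])
             (simp add: deriv_test_fun.rep_eq)
        show "continuous_on UNIV (\<lambda>x. H x * deriv_test_fun \<psi> x + \<phi> x * \<psi> x)"
          by (intro continuous_intros contH test_fun_continuous)
        show "H x * \<psi> x = 0" if "\<bar>x\<bar> > s" for x
          using s[OF that] by simp
      qed
      then show ?thesis
        by (simp add: integrable_mult_test_fun[OF lH] integrable_mult_test_fun[OF l\<phi>])
    qed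
    then show ?thesis
      by (intro distribution_eqI) (simp add: deriv_distribution.rep_eq distribution_of.rep_eq lH l\<phi>)
  qed
  ultimately show ?thesis by blast
qed

lift_definition ac_of_test_fun :: "test_fun \<Rightarrow> ac" is "\<lambda>\<phi> :: test_fun. distribution_of \<phi>"
  by (rule distribution_of_test_fun_primitive)


section \<open>Functions of essentially bounded variation and the integral\<close>

definition essvar :: "(real \<Rightarrow> real) \<Rightarrow> ereal" where
  "essvar g = (SUP \<phi>\<in>{\<phi>. \<phi> C1_differentiable_on UNIV \<and> compact (closure {x. \<phi> x \<noteq> 0}) \<and> (\<forall>x. \<bar>\<phi> x\<bar> \<le> 1)}.
     ereal (LINT x|lebesgue. g x * deriv \<phi> x))"

definition EBV :: "(real \<Rightarrow> real) set" where
  "EBV = {g. locally_integrable g \<and> essvar g < \<infinity>}"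

text \<open>For \<open>g \<in> EBV\<close> the limit exists for every approximating sequence and does not depend on the
  sequence, so the description picks out that limit.\<close>

definition ac_integral :: "ac \<Rightarrow> (real \<Rightarrow> real) \<Rightarrow> real" where
  "ac_integral f g =
    (THE I. \<forall>\<phi>. (\<lambda>n. norm (f - ac_of_test_fun (\<phi> n))) \<longlonglongrightarrow> 0 \<longrightarrow>
      (\<lambda>n. LINT x|lebesgue. \<phi> n x * g x) \<longlonglongrightarrow> I)"

end

theory Submission
  imports Defs
begin

text \<open>For \<open>g \<in> EBV\<close> the map \<open>\<phi> \<mapsto> \<integral>\<phi> g\<close> is bounded on test functions in the Alexiewicz norm,
  and test functions are dense (interpolate the primitive by smooth steps), so it extends to a bounded
  functional. Conversely, a functional \<open>\<Lambda>\<close> is evaluated on the derivatives of continuous ramps that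
  increase to the step at \<open>t\<close>: the values converge because \<open>\<Lambda>\<close> is bounded on all signed sums of
  the increments of the ramps, and the limit is \<open>g t\<close>. Writing a primitive \<open>F\<close> as the limit of the Banach space
  valued integrals of \<open>F' t\<close> times the ramp at \<open>t\<close> gives \<open>\<Lambda> F' = \<integral>F' g\<close>, which bounds the essential variation
  of \<open>g\<close> by the norm of \<open>\<Lambda>\<close>.\<close>

section \<open>Smooth steps and density of the test functions\<close>

lemma smooth_scale: "smooth f \<Longrightarrow> smooth (\<lambda>x. c * f x)"
  using smooth_lincomb[of f f c 0] by simp

lemma smooth_add: "smooth f \<Longrightarrow> smooth g \<Longrightarrow> smooth (\<lambda>x. f x + g x)"
  using smooth_lincomb[of f g 1 1] by simp

lemma smooth_diff: "smooth f \<Longrightarrow> smooth g \<Longrightarrow> smooth (\<lambda>x. f x - g x)"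
  using smooth_lincomb[of f g 1 "-1"] by simp

text \<open>Such a step is a normalised antiderivative of a bump. The bump \<open>\<rho>\<close> is
  a product of two reflected translates of the flat function \<open>exp (- (1 / x))\<close>, hence
  positive strictly between -1 and 1 and zero outside.\<close>

lemma smooth_step_exists:
  obtains \<sigma> where "smooth \<sigma>" "\<And>x. x \<le> 0 \<Longrightarrow> \<sigma> x = 0" "\<And>x. x \<ge> 1 \<Longrightarrow> \<sigma> x = 1"
    "\<And>x. 0 \<le> \<sigma> x" "\<And>x. \<sigma> x \<le> 1"
proof -
  define \<rho> where "\<rho> x = flat 1 (1 + 1 * x) * flat 1 (1 + (- 1) * x)" for x
  have \<rho>: "smooth \<rho>"
    unfolding \<rho>_def by (intro smooth_mult smooth_affine smooth_flat)
  have \<rho>_nonneg: "\<rho> x \<ge> 0" for x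
    by (simp add: \<rho>_def flat_def)
  have \<rho>_pos: "\<rho> x > 0" if "\<bar>x\<bar> < 1" for x
    using that by (simp add: \<rho>_def flat_def)
  have \<rho>_zero: "\<rho> x = 0" if "\<bar>x\<bar> > 1" for x
    using that by (auto simp: \<rho>_def flat_def)
  obtain H c where H: "\<And>x. (H has_real_derivative \<rho> x) (at x)"
      "\<And>x. x < - 1 \<Longrightarrow> H x = 0" "\<And>x. x > 1 \<Longrightarrow> H x = c"
    using antiderivative_compact_support[OF smooth_continuous[OF \<rho>] \<rho>_zero] by blast
  have mono: "H x \<le> H y" if "x \<le> y" for x y
    by (rule DERIV_nonneg_imp_nondecreasing[OF that]) (use H(1) \<rho>_nonneg in blast)
  \<comment> \<open>Strict growth on one piece of the support makes the total mass \<open>c\<close>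
    positive, so that dividing by it is legitimate.\<close>
  have "H 0 < H (1/2)"
  proof (rule DERIV_pos_imp_increasing[where f = H])
    show "\<exists>y. (H has_real_derivative y) (at x) \<and> y > 0" if "0 \<le> x" "x \<le> 1/2" for x
      by (rule exI[of _ "\<rho> x"]) (use H(1) \<rho>_pos that in simp)
  qed simp
  then have "c > 0"
    using mono[of "-2" 0] mono[of "1/2" 2] H(2)[of "-2"] H(3)[of 2] by linarith
  \<comment> \<open>The affine map sends 0 to -2 and 1 to 2; both lie strictly beyond the support of
    \<open>\<rho>\<close>, where \<open>H\<close> is known to be 0 and \<open>c\<close>.\<close>
  define \<sigma> where "\<sigma> x = 1 / c * H (- 2 + 4 * x)" for x
  show thesis
  proof
    show "smooth \<sigma>"
      unfolding \<sigma>_def by (intro smooth_scale smooth_affine smoothI[OF H(1) \<rho>])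
    show "\<sigma> x = 0" if "x \<le> 0" for x using that by (simp add: \<sigma>_def H(2))
    show "\<sigma> x = 1" if "x \<ge> 1" for x using that \<open>c > 0\<close> by (simp add: \<sigma>_def H(3))
    have "0 \<le> H y \<and> H y \<le> c" for y
      using mono[of "min y (-2)" y] mono[of y "max y 2"] H(2)[of "min y (-2)"] H(3)[of "max y 2"]
      by simp
    then show "0 \<le> \<sigma> x" "\<sigma> x \<le> 1" for x using \<open>c > 0\<close> by (simp_all add: \<sigma>_def)
  qed
qed

text \<open>Integration by parts: \<open>F x * \<psi> x\<close> has compact support, so its
  derivative integrates to zero. Membership in \<open>BC\<close> fixes the constant of
  integration.\<close>

lemma primitive_ac_of_test_fun:
  fixes \<phi> :: test_fun
  assumes F: "F \<in> BC" and deriv: "\<And>x. (F has_real_derivative \<phi> x) (at x)"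
  shows "primitive (ac_of_test_fun \<phi>) = F"
proof (rule primitive_eqI[OF F])
  have contF: "continuous_on UNIV F" using F by (simp add: BC_def)
  have lF: "locally_integrable F" and l\<phi>: "locally_integrable \<phi>"
    by (auto intro: locally_integrable_continuous contF test_fun_continuous)
  have "(LINT x|lebesgue. \<phi> x * \<psi> x) = - (LINT x|lebesgue. F x * deriv_test_fun \<psi> x)"
    for \<psi> :: test_fun
  proof -
    obtain s where s: "\<And>x. \<bar>x\<bar> > s \<Longrightarrow> \<psi> x = 0"
      using test_fun_support by blast
    have "(LINT x|lebesgue. F x * deriv_test_fun \<psi> x + \<phi> x * \<psi> x) = 0"
    proof (rule integral_derivative_compact_support)
      show "((\<lambda>x. F x * \<psi> x) has_real_derivative F x * deriv_test_fun \<psi> x + \<phi> x * \<psi> x) (at x)" for x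
        by (rule DERIV_mult[OF deriv smooth_DERIV[OF test_fun_smooth], THEN DERIV_cong])
           (simp add: deriv_test_fun.rep_eq)
      show "continuous_on UNIV (\<lambda>x. F x * deriv_test_fun \<psi> x + \<phi> x * \<psi> x)"
        by (intro continuous_intros contF test_fun_continuous)
      show "F x * \<psi> x = 0" if "\<bar>x\<bar> > s" for x
        using s[OF that] by simp
    qed
    then show ?thesis
      by (simp add: integrable_mult_test_fun[OF lF] integrable_mult_test_fun[OF l\<phi>])
  qed
  then show "distribution_of_ac (ac_of_test_fun \<phi>) = deriv_distribution (distribution_of F)"
    by (intro distribution_eqI)
       (simp add: ac_of_test_fun.rep_eq deriv_distribution.rep_eq distribution_of.rep_eq lF l\<phi>)
qed

lemma BC_eventually_constant:
  assumes "continuous_on UNIV F" "\<And>x. x < - r \<Longrightarrow> F x = 0" "\<And>x. x > r \<Longrightarrow> F x = c"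
  shows "F \<in> BC"
proof -
  have "(F \<longlongrightarrow> c) at_top"
    by (rule tendsto_eventually, rule eventually_mono[OF eventually_gt_at_top[of r]]) (rule assms)
  moreover have "(F \<longlongrightarrow> 0) at_bot"
    by (rule tendsto_eventually, rule eventually_mono[OF eventually_gt_at_bot[of "- r"]]) (rule assms)
  ultimately show ?thesis
    using assms(1) by (auto simp: BC_def)
qed

text \<open>Since \<open>F\<close> is constant near both ends, its derivative has compact support.
  Test functions can therefore be built through their primitives, and density in the Alexiewicz norm
  becomes uniform approximation of primitives.\<close>

lemma test_fun_of_smooth_primitive:
  assumes F: "smooth F" "\<And>x. x < - r \<Longrightarrow> F x = 0" "\<And>x. x > r \<Longrightarrow> F x = c"
  obtains \<phi> :: test_fun where "\<And>x. \<phi> x = deriv F x" "primitive (ac_of_test_fun \<phi>) = F"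
proof -
  have "deriv F x = 0" if "\<bar>x\<bar> > r" for x
  proof (cases "x < - r")
    case True
    show ?thesis
      by (rule DERIV_imp_deriv[OF DERIV_locally_zero[of "{..<- r}"]]) (use True F(2) in auto)
  next
    case False
    have "((\<lambda>y. F y - c) has_real_derivative 0) (at x)"
      by (rule DERIV_locally_zero[of "{r<..}"]) (use False that F(3) in auto)
    from DERIV_add[OF this DERIV_const[of c]] show ?thesis
      by (simp add: DERIV_imp_deriv)
  qed
  then have "compact (closure {x. deriv F x \<noteq> 0})"
    unfolding compact_support_iff by blast
  then have ap: "apply_test_fun (Abs_test_fun (deriv F)) = deriv F"
    using smooth_deriv[OF F(1)] by (simp add: Abs_test_fun_inverse del: compact_closure)
  show thesis
  proof
    show "primitive (ac_of_test_fun (Abs_test_fun (deriv F))) = F"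
      by (rule primitive_ac_of_test_fun[OF BC_eventually_constant[OF smooth_continuous[OF F(1)] F(2,3)]])
         (simp_all add: ap smooth_DERIV F(1))
  qed (simp add: ap)
qed

text \<open>Induction on the nodes: each step adds the increment of \<open>F\<close> between two
  neighbouring nodes, spread over that interval by a smooth step. There the error is a convex
  combination of deviations from node values. The factor 2 comes from the left tail, where
  \<open>F\<close> and \<open>G\<close> are each only known to be at most \<open>e\<close> in
  absolute value.\<close>

lemma smooth_interpolation:
  fixes F :: "real \<Rightarrow> real" and t :: "nat \<Rightarrow> real"
  assumes t: "\<And>i. t i < t (Suc i)" and left: "\<And>x. x \<le> t 0 \<Longrightarrow> \<bar>F x\<bar> \<le> e"
    and osc: "\<And>i x. i < n \<Longrightarrow> t i \<le> x \<Longrightarrow> x \<le> t (Suc i) \<Longrightarrow> \<bar>F x - F (t i)\<bar> \<le> e \<and> \<bar>F x - F (t (Suc i))\<bar> \<le> e"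
  shows "\<exists>G. smooth G \<and> (\<forall>x \<le> t 0 - 1. G x = 0) \<and> (\<forall>x \<ge> t n. G x = F (t n)) \<and>
    (\<forall>x \<le> t n. \<bar>F x - G x\<bar> \<le> 2 * e)"
  using osc
proof (induction n)
  case 0
  obtain \<sigma> where \<sigma>: "smooth \<sigma>" "\<And>x. x \<le> 0 \<Longrightarrow> \<sigma> x = 0" "\<And>x. x \<ge> 1 \<Longrightarrow> \<sigma> x = 1"
    "\<And>x. 0 \<le> \<sigma> x" "\<And>x. \<sigma> x \<le> 1"
    using smooth_step_exists by blast
  \<comment> \<open>This climbs from 0 at \<open>t 0 - 1\<close> to \<open>F (t 0)\<close> at
    \<open>t 0\<close>.\<close>
  define G where "G x = F (t 0) * \<sigma> (1 - t 0 + 1 * x)" for x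
  have "smooth G"
    unfolding G_def by (intro smooth_scale smooth_affine \<sigma>)
  moreover have "\<forall>x \<le> t 0 - 1. G x = 0" "\<forall>x \<ge> t 0. G x = F (t 0)"
    by (simp_all add: G_def \<sigma>(2,3))
  moreover have "\<bar>F x - G x\<bar> \<le> 2 * e" if "x \<le> t 0" for x
  proof -
    have "\<bar>G x\<bar> \<le> \<bar>F (t 0)\<bar>"
      unfolding G_def using \<sigma>(4,5) by (simp add: abs_mult mult_left_le)
    then show ?thesis
      using left[OF that] left[of "t 0"] by linarith
  qed
  ultimately show ?case
    by blast
next
  case (Suc n)
  obtain \<sigma> where \<sigma>: "smooth \<sigma>" "\<And>x. x \<le> 0 \<Longrightarrow> \<sigma> x = 0" "\<And>x. x \<ge> 1 \<Longrightarrow> \<sigma> x = 1"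
    "\<And>x. 0 \<le> \<sigma> x" "\<And>x. \<sigma> x \<le> 1"
    using smooth_step_exists by blast
  obtain G where G: "smooth G" "\<And>x. x \<le> t 0 - 1 \<Longrightarrow> G x = 0" "\<And>x. x \<ge> t n \<Longrightarrow> G x = F (t n)"
    "\<And>x. x \<le> t n \<Longrightarrow> \<bar>F x - G x\<bar> \<le> 2 * e"
    using Suc.IH[OF Suc.prems[OF less_SucI]] by blast
  define h where "h = t (Suc n) - t n"
  have h: "h > 0" using t[of n] by (simp add: h_def)
  define s where "s x = \<sigma> (- t n / h + 1 / h * x)" for x
  have s_eq: "s x = \<sigma> ((x - t n) / h)" for x
    by (simp add: s_def diff_divide_distrib algebra_simps)
  have s0: "s x = 0" if "x \<le> t n" for x
    using that h by (simp add: s_eq \<sigma>(2) divide_nonpos_pos)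
  have s1: "s x = 1" if "x \<ge> t (Suc n)" for x
    using that h by (simp add: s_eq \<sigma>(3) h_def)
  define K where "K x = G x + (F (t (Suc n)) - F (t n)) * s x" for x
  have t0: "t 0 \<le> t n"
    by (rule lift_Suc_mono_le[where f = t]) (use t less_imp_le in auto)
  have "smooth K"
    unfolding K_def s_def by (intro smooth_add smooth_scale smooth_affine G \<sigma>)
  moreover have "K x = 0" if "x \<le> t 0 - 1" for x
    using that t0 by (simp add: K_def G(2) s0)
  moreover have "K x = F (t (Suc n))" if "x \<ge> t (Suc n)" for x
    using that t[of n] by (simp add: K_def G(3) s1)
  moreover have "\<bar>F x - K x\<bar> \<le> 2 * e" if "x \<le> t (Suc n)" for x
  proof (cases "x \<le> t n")
    case True
    then show ?thesis by (simp add: K_def s0 G(4))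
  next
    case False
    have o: "\<bar>F x - F (t n)\<bar> \<le> e" "\<bar>F x - F (t (Suc n))\<bar> \<le> e"
      using Suc.prems[of n x] False that by auto
    \<comment> \<open>The weights \<open>1 - s x\<close> and \<open>s x\<close> are nonnegative and
      add up to 1, so this error stays below \<open>e\<close>.\<close>
    have "F x - K x = (1 - s x) * (F x - F (t n)) + s x * (F x - F (t (Suc n)))"
      using False by (simp add: K_def G(3) algebra_simps)
    also have "\<bar>\<dots>\<bar> \<le> (1 - s x) * e + s x * e"
      using o \<sigma>(4,5)
      by (intro order.trans[OF abs_triangle_ineq] add_mono)
         (auto simp: abs_mult s_eq intro!: mult_left_mono)
    finally show ?thesis using o by (simp add: algebra_simps)
  qed
  ultimately show ?case by blast
qed

text \<open>Outside a compact interval the primitive is close to its limits; inside, uniform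
  continuity gives a mesh fine enough for interpolation. The interpolant is constant near both ends,
  hence the primitive of a test function.\<close>

lemma test_fun_dense:
  assumes "e > 0"
  shows "\<exists>\<phi>. norm (f - ac_of_test_fun \<phi>) < e"
proof -
  \<comment> \<open>The interpolation error is \<open>2 * d\<close>, and so is the error in the
    right tail, where \<open>F x\<close> and \<open>F b\<close> are both within \<open>d\<close> of
    \<open>l\<close>. A third of \<open>e\<close> leaves a strict inequality.\<close>
  define d where "d = e / 3"
  have d: "d > 0" using assms by (simp add: d_def)
  define F where "F = primitive f"
  obtain l where F: "continuous_on UNIV F" "(F \<longlongrightarrow> l) at_top" "(F \<longlongrightarrow> 0) at_bot"
    using primitive_in_BC[of f] by (auto simp: BC_def F_def)
  obtain a where a: "\<And>x. x \<le> a \<Longrightarrow> \<bar>F x\<bar> < d"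
    using tendstoD[OF F(3) d] by (auto simp: eventually_at_bot_linorder dist_real_def)
  obtain b0 where b0: "\<And>x. x \<ge> b0 \<Longrightarrow> \<bar>F x - l\<bar> < d"
    using tendstoD[OF F(2) d] by (auto simp: eventually_at_top_linorder dist_real_def)
  \<comment> \<open>Taking the maximum with \<open>a + 1\<close> keeps the interval nondegenerate,
    so the mesh width \<open>h\<close> is positive.\<close>
  define b where "b = max b0 (a + 1)"
  have "uniformly_continuous_on {a..b} F"
    by (intro compact_uniformly_continuous continuous_on_subset[OF F(1)]) auto
  then obtain \<delta> where \<delta>: "\<delta> > 0"
    "\<And>x y. x \<in> {a..b} \<Longrightarrow> y \<in> {a..b} \<Longrightarrow> dist x y < \<delta> \<Longrightarrow> dist (F x) (F y) < d"
    unfolding uniformly_continuous_on_def using d by metis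
  obtain n where n: "(b - a) / \<delta> < real n" "n > 0"
    using reals_Archimedean2[of "max 1 ((b - a) / \<delta>)"] by (auto simp: not_le intro!: that)
  define h where "h = (b - a) / real n"
  have h: "h > 0" "h < \<delta>"
    using n \<delta>(1) by (auto simp: h_def b_def field_simps)
  define t where "t i = a + real i * h" for i
  have tn: "t n = b" using n by (simp add: t_def h_def)
  have "\<exists>G. smooth G \<and> (\<forall>x \<le> t 0 - 1. G x = 0) \<and> (\<forall>x \<ge> t n. G x = F (t n)) \<and>
    (\<forall>x \<le> t n. \<bar>F x - G x\<bar> \<le> 2 * d)"
  proof (rule smooth_interpolation)
    show "t i < t (Suc i)" for i using h by (simp add: t_def algebra_simps)
    show "\<bar>F x\<bar> \<le> d" if "x \<le> t 0" for x using a[of x] that by (simp add: t_def)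
    fix i x assume ix: "i < n" "t i \<le> x" "x \<le> t (Suc i)"
    have "real (Suc i) * h \<le> real n * h" using ix h by (intro mult_right_mono) auto
    then have "t (Suc i) \<le> b" unfolding tn[symmetric] by (simp add: t_def)
    moreover have "a \<le> t i" using h by (simp add: t_def)
    moreover have "t (Suc i) - t i = h" by (simp add: t_def algebra_simps)
    ultimately show "\<bar>F x - F (t i)\<bar> \<le> d \<and> \<bar>F x - F (t (Suc i))\<bar> \<le> d"
      using \<delta>(2)[of x "t i"] \<delta>(2)[of x "t (Suc i)"] ix h by (auto simp: dist_real_def)
  qed
  then obtain G where G: "smooth G" "\<And>x. x \<le> a - 1 \<Longrightarrow> G x = 0" "\<And>x. x \<ge> b \<Longrightarrow> G x = F b"
    "\<And>x. x \<le> b \<Longrightarrow> \<bar>F x - G x\<bar> \<le> 2 * d"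
    by (auto simp: tn) (auto simp: t_def)
  define r where "r = max (1 - a) b"
  have "\<And>x. x < - r \<Longrightarrow> G x = 0" "\<And>x. x > r \<Longrightarrow> G x = F b"
    using G(2,3) by (auto simp: r_def)
  then obtain \<phi> :: test_fun where \<phi>: "primitive (ac_of_test_fun \<phi>) = G"
    using test_fun_of_smooth_primitive[OF G(1)] by metis
  have "\<bar>F x - G x\<bar> \<le> 2 * d" for x
  proof (cases "x \<le> b")
    case False
    then have "x \<ge> b0" "b \<ge> b0" "x \<ge> b"
      by (auto simp: b_def)
    then have "\<bar>F x - l\<bar> < d" "\<bar>F b - l\<bar> < d" "G x = F b"
      using G(3) b0 by blast+
    then show ?thesis by linarith
  qed (rule G(4))
  then have "norm (f - ac_of_test_fun \<phi>) \<le> 2 * d"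
    by (intro norm_ac_leI) (simp add: primitive_diff \<phi> F_def)
  then show ?thesis using d by (intro exI[of _ \<phi>]) (simp add: d_def)
qed

lemma test_fun_sequence:
  obtains \<phi> where "(\<lambda>n. norm (f - ac_of_test_fun (\<phi> n))) \<longlonglongrightarrow> 0"
proof -
  have "\<forall>n. \<exists>\<phi>. norm (f - ac_of_test_fun \<phi>) < 1 / real (Suc n)"
    by (intro allI test_fun_dense) simp
  then obtain \<phi> where \<phi>: "\<And>n. norm (f - ac_of_test_fun (\<phi> n)) < 1 / real (Suc n)"
    by metis
  have "(\<lambda>n. norm (f - ac_of_test_fun (\<phi> n))) \<longlonglongrightarrow> 0"
    by (rule tendsto_sandwich[OF _ _ tendsto_const LIMSEQ_Suc[OF lim_inverse_n']])
       (use \<phi> in \<open>auto intro!: always_eventually less_imp_le simp del: of_nat_Suc\<close>)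
  then show thesis by (rule that)
qed

section \<open>The integral against functions of essentially bounded variation\<close>

lemma ac_of_test_fun_add: "ac_of_test_fun (\<phi> + \<psi>) = ac_of_test_fun \<phi> + ac_of_test_fun \<psi>"
  and ac_of_test_fun_diff: "ac_of_test_fun (\<phi> - \<psi>) = ac_of_test_fun \<phi> - ac_of_test_fun \<psi>"
  and ac_of_test_fun_scaleR: "ac_of_test_fun (c *\<^sub>R \<phi>) = c *\<^sub>R ac_of_test_fun \<phi>"
proof -
  have l: "locally_integrable (apply_test_fun \<phi>)" for \<phi>
    by (rule locally_integrable_continuous[OF test_fun_continuous])
  have "distribution_of (\<lambda>x. a * \<phi> x + b * \<psi> x) = a *\<^sub>R distribution_of \<phi> + b *\<^sub>R distribution_of \<psi>" for a b
    by (rule distribution_of_lincomb[OF l l])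
  from this[of 1 1] this[of 1 "-1"] this[of c 0]
  show "ac_of_test_fun (\<phi> + \<psi>) = ac_of_test_fun \<phi> + ac_of_test_fun \<psi>"
    "ac_of_test_fun (\<phi> - \<psi>) = ac_of_test_fun \<phi> - ac_of_test_fun \<psi>"
    "ac_of_test_fun (c *\<^sub>R \<phi>) = c *\<^sub>R ac_of_test_fun \<phi>"
    by (simp_all add: distribution_of_ac_inject[symmetric] ac_of_test_fun.rep_eq plus_ac.rep_eq
        minus_ac.rep_eq scaleR_ac.rep_eq plus_test_fun.rep_eq minus_test_fun.rep_eq scaleR_test_fun.rep_eq)
qed

text \<open>The description quantifies over all approximating sequences and would be vacuous if
  there were none. Density supplies one, and uniqueness of its limit determines the value.\<close>

lemma ac_integral_eqI:
  assumes "\<And>\<phi>. (\<lambda>n. norm (f - ac_of_test_fun (\<phi> n))) \<longlonglongrightarrow> 0 \<Longrightarrow>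
      (\<lambda>n. LINT x|lebesgue. \<phi> n x * g x) \<longlonglongrightarrow> I"
  shows "ac_integral f g = I"
  unfolding ac_integral_def
proof (rule the_equality)
  show "\<forall>\<phi>. (\<lambda>n. norm (f - ac_of_test_fun (\<phi> n))) \<longlonglongrightarrow> 0 \<longrightarrow>
      (\<lambda>n. LINT x|lebesgue. \<phi> n x * g x) \<longlonglongrightarrow> I"
    using assms by blast
next
  fix J assume J: "\<forall>\<phi>. (\<lambda>n. norm (f - ac_of_test_fun (\<phi> n))) \<longlonglongrightarrow> 0 \<longrightarrow>
      (\<lambda>n. LINT x|lebesgue. \<phi> n x * g x) \<longlonglongrightarrow> J"
  obtain \<phi> where "(\<lambda>n. norm (f - ac_of_test_fun (\<phi> n))) \<longlonglongrightarrow> 0"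
    by (rule test_fun_sequence)
  then show "J = I"
    using J assms LIMSEQ_unique by blast
qed

section \<open>Estimates from the essential variation\<close>

lemma smooth_C1: "smooth f \<Longrightarrow> f C1_differentiable_on S"
  unfolding C1_differentiable_on_def
  by (rule exI[of _ "deriv f"])
     (use smooth_DERIV smooth_continuous[OF smooth_deriv] has_real_derivative_iff_has_vector_derivative in blast)

text \<open>The one-sided supremum over functions bounded by 1 yields a homogeneous two-sided
  estimate: it is applied to \<open>\<psi>\<close> multiplied by \<open>1 / M\<close> and by
  \<open>- 1 / M\<close>. The constant \<open>V\<close> is any natural number above the essential
  variation.\<close>

lemma EBV_integral_deriv_bounded:
  assumes "g \<in> EBV"
  obtains V where "V \<ge> 0" "\<And>\<psi> M. smooth \<psi> \<Longrightarrow> compact (closure {x. \<psi> x \<noteq> 0}) \<Longrightarrow> (\<And>x. \<bar>\<psi> x\<bar> \<le> M) \<Longrightarrow>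
    \<bar>LINT x|lebesgue. g x * deriv \<psi> x\<bar> \<le> V * M"
proof -
  have "essvar g < \<infinity>" using assms by (simp add: EBV_def)
  then obtain n :: nat where n: "essvar g < ereal (real n)"
    using less_PInf_Ex_of_nat by auto
  have le: "(LINT x|lebesgue. g x * deriv \<psi> x) \<le> real n"
    if "smooth \<psi>" "compact (closure {x. \<psi> x \<noteq> 0})" "\<And>x. \<bar>\<psi> x\<bar> \<le> 1" for \<psi>
  proof -
    have "ereal (LINT x|lebesgue. g x * deriv \<psi> x) \<le> essvar g"
      unfolding essvar_def using that by (intro SUP_upper) (auto simp: smooth_C1 simp del: compact_closure)
    then have "ereal (LINT x|lebesgue. g x * deriv \<psi> x) \<le> ereal (real n)"
      using n by (meson less_imp_le order.trans)
    then show ?thesis by simp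
  qed
  show thesis
  proof (rule that[of "real n"])
    fix \<psi> M assume \<psi>: "smooth \<psi>" "compact (closure {x. \<psi> x \<noteq> 0})" "\<And>x :: real. \<bar>\<psi> x\<bar> \<le> M"
    show "\<bar>LINT x|lebesgue. g x * deriv \<psi> x\<bar> \<le> real n * M"
    proof (cases "M > 0")
      case False
      then have "\<psi> x = 0" for x using \<psi>(3)[of x] by linarith
      then have "\<psi> = (\<lambda>x. 0)" by blast
      then show ?thesis using \<psi>(3)[of 0] by simp
    next
      case True
      have "c * (LINT x|lebesgue. g x * deriv \<psi> x) \<le> real n" if c: "\<bar>c\<bar> = 1 / M" for c
      proof -
        have "compact (closure {x. c * \<psi> x \<noteq> 0})"
          using \<psi>(2) unfolding compact_support_iff by auto
        moreover have "\<bar>c * \<psi> x\<bar> \<le> 1" for x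
          using mult_left_mono[OF \<psi>(3)[of x], of "\<bar>c\<bar>"] True c by (simp add: abs_mult)
        moreover have "deriv (\<lambda>x. c * \<psi> x) x = c * deriv \<psi> x" for x
          by (rule DERIV_imp_deriv) (auto intro!: derivative_eq_intros smooth_DERIV \<psi>(1))
        ultimately show ?thesis
          using le[OF smooth_scale[OF \<psi>(1), of c]] by (simp add: mult.left_commute del: compact_closure)
      qed
      from this[of "1 / M"] this[of "- 1 / M"] show ?thesis
        using True by (simp add: field_simps abs_le_iff)
    qed
  qed simp
qed

text \<open>The primitive of \<open>\<phi>\<close> need not have compact support; subtracting a multiple of a fixed smooth step
  makes the definition of the essential variation applicable.\<close>

lemma EBV_pairing_bounded:
  assumes g: "g \<in> EBV"
  obtains C where "\<And>\<phi>. \<bar>LINT x|lebesgue. apply_test_fun \<phi> x * g x\<bar> \<le> C * norm (ac_of_test_fun \<phi>)"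
proof -
  obtain V where V: "V \<ge> 0" "\<And>\<psi> M. smooth \<psi> \<Longrightarrow> compact (closure {x. \<psi> x \<noteq> 0}) \<Longrightarrow> (\<And>x. \<bar>\<psi> x\<bar> \<le> M) \<Longrightarrow>
    \<bar>LINT x|lebesgue. g x * deriv \<psi> x\<bar> \<le> V * M"
    using EBV_integral_deriv_bounded[OF g] by blast
  have lg: "locally_integrable g" using g by (simp add: EBV_def)
  obtain \<sigma> where \<sigma>: "smooth \<sigma>" "\<And>x. x \<le> 0 \<Longrightarrow> \<sigma> x = 0" "\<And>x. x \<ge> 1 \<Longrightarrow> \<sigma> x = 1"
    "\<And>x. 0 \<le> \<sigma> x" "\<And>x. \<sigma> x \<le> 1"
    using smooth_step_exists by blast
  obtain \<eta> :: test_fun where \<eta>: "\<And>x. \<eta> x = deriv \<sigma> x"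
    by (rule test_fun_of_smooth_primitive[OF \<sigma>(1), of 1 1]) (auto simp: \<sigma>)
  define B where "B = \<bar>LINT x|lebesgue. g x * \<eta> x\<bar>"
  \<comment> \<open>The corrected primitive is bounded by twice the norm, since \<open>F\<close> and
    its final value \<open>c\<close> are each bounded by the norm; this gives \<open>2 * V\<close>.
    The subtracted multiple of \<open>\<eta>\<close> contributes at most \<open>B\<close> times the
    norm.\<close>
  have "\<bar>LINT x|lebesgue. \<phi> x * g x\<bar> \<le> (2 * V + B) * norm (ac_of_test_fun \<phi>)" for \<phi> :: test_fun
  proof -
    define N where "N = norm (ac_of_test_fun \<phi>)"
    obtain r where r: "\<And>x. \<bar>x\<bar> > r \<Longrightarrow> \<phi> x = 0"
      using test_fun_support by blast
    obtain F c where F: "\<And>x. (F has_real_derivative \<phi> x) (at x)"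
        "\<And>x. x < - r \<Longrightarrow> F x = 0" "\<And>x. x > r \<Longrightarrow> F x = c"
      using antiderivative_compact_support[OF test_fun_continuous r] by blast
    have smF: "smooth F" by (rule smoothI[OF F(1) test_fun_smooth])
    have "primitive (ac_of_test_fun \<phi>) = F"
      by (rule primitive_ac_of_test_fun[OF BC_eventually_constant[OF smooth_continuous[OF smF] F(2,3)] F(1)])
    then have FN: "\<bar>F x\<bar> \<le> N" for x
      using primitive_le_norm[of "ac_of_test_fun \<phi>" x] by (simp add: N_def)
    have cN: "\<bar>c\<bar> \<le> N" using FN[of "r + 1"] F(3)[of "r + 1"] by simp
    define \<psi> where "\<psi> x = F x - c * \<sigma> x" for x
    have "smooth \<psi>" unfolding \<psi>_def by (intro smooth_diff smooth_scale smF \<sigma>)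
    moreover have "\<psi> x = 0" if "\<bar>x\<bar> > max r 1" for x
      using that F(2,3)[of x] \<sigma>(2,3)[of x] by (cases "x > 0") (auto simp: \<psi>_def)
    then have "compact (closure {x. \<psi> x \<noteq> 0})" unfolding compact_support_iff by blast
    moreover have "\<bar>\<psi> x\<bar> \<le> 2 * N" for x
    proof -
      have "\<bar>c * \<sigma> x\<bar> \<le> \<bar>c\<bar>" using \<sigma>(4,5) by (simp add: abs_mult mult_left_le)
      then show ?thesis using FN[of x] cN by (simp add: \<psi>_def)
    qed
    ultimately have "\<bar>LINT x|lebesgue. g x * deriv \<psi> x\<bar> \<le> V * (2 * N)"
      by (rule V(2))
    moreover have "deriv \<psi> x = \<phi> x - c * \<eta> x" for x
      unfolding \<psi>_def \<eta>
      by (rule DERIV_imp_deriv) (auto intro!: derivative_eq_intros F(1) smooth_DERIV[OF \<sigma>(1)])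
    then have "(LINT x|lebesgue. g x * deriv \<psi> x) = (LINT x|lebesgue. g x * \<phi> x) - c * (LINT x|lebesgue. g x * \<eta> x)"
      using integrable_mult_test_fun[OF lg] by (simp add: right_diff_distrib mult.left_commute)
    moreover have "\<bar>c * (LINT x|lebesgue. g x * \<eta> x)\<bar> \<le> N * B"
      unfolding B_def abs_mult by (intro mult_right_mono cN) auto
    ultimately show ?thesis
      by (simp add: algebra_simps N_def[symmetric])
  qed
  then show thesis by (rule that)
qed

text \<open>On test functions the pairing with \<open>g\<close> is Lipschitz for the Alexiewicz
  norm. An approximating sequence thus has Cauchy pairings, and two such sequences have pairings
  differing by a null sequence, so the description in \<open>ac_integral\<close> is
  meaningful.\<close>

lemma ac_integral_limit:
  assumes g: "g \<in> EBV" and \<phi>: "(\<lambda>n. norm (f - ac_of_test_fun (\<phi> n))) \<longlonglongrightarrow> 0"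
  shows "(\<lambda>n. LINT x|lebesgue. \<phi> n x * g x) \<longlonglongrightarrow> ac_integral f g"
proof -
  define L where "L \<phi> = (LINT x|lebesgue. \<phi> x * g x)" for \<phi> :: test_fun
  obtain C where C: "\<And>\<phi>. \<bar>L \<phi>\<bar> \<le> C * norm (ac_of_test_fun \<phi>)"
    using EBV_pairing_bounded[OF g] unfolding L_def by blast
  have "locally_integrable g" using g by (simp add: EBV_def)
  note int = integrable_mult_test_fun[OF this]
  have "L \<phi> - L \<psi> = L (\<phi> - \<psi>)" for \<phi> \<psi>
    unfolding L_def using int[of \<phi>] int[of \<psi>]
    by (simp add: minus_test_fun.rep_eq right_diff_distrib mult.commute[of _ "g _"])
  then have C2: "\<bar>L \<phi> - L \<psi>\<bar> \<le> C * norm (ac_of_test_fun \<phi> - ac_of_test_fun \<psi>)" for \<phi> \<psi>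
    using C[of "\<phi> - \<psi>"] by (simp add: ac_of_test_fun_diff)
  have conv: "(\<lambda>n. ac_of_test_fun (\<phi> n)) \<longlonglongrightarrow> f" if "(\<lambda>n. norm (f - ac_of_test_fun (\<phi> n))) \<longlonglongrightarrow> 0" for \<phi>
    using that by (simp add: LIM_zero_iff tendsto_norm_zero_iff norm_minus_commute[of f])
  have "Cauchy (\<lambda>n. L (\<phi> n))"
  proof (rule metric_CauchyI)
    fix e :: real assume "e > 0"
    have "Cauchy (\<lambda>n. ac_of_test_fun (\<phi> n))"
      using conv[OF \<phi>] by (rule LIMSEQ_imp_Cauchy)
    \<comment> \<open>The sign of \<open>C\<close> is unspecified, and it may be zero;
      \<open>\<bar>C\<bar> + 1\<close> is a positive divisor in every case.\<close>
    then obtain N where N: "\<And>m n. m \<ge> N \<Longrightarrow> n \<ge> N \<Longrightarrow>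
        dist (ac_of_test_fun (\<phi> m)) (ac_of_test_fun (\<phi> n)) < e / (\<bar>C\<bar> + 1)"
      using metric_CauchyD[of _ "e / (\<bar>C\<bar> + 1)"] \<open>e > 0\<close> by (metis abs_add_one_gt_zero add.commute divide_pos_pos)
    have "dist (L (\<phi> m)) (L (\<phi> n)) < e" if "m \<ge> N" "n \<ge> N" for m n
    proof -
      define D where "D = dist (ac_of_test_fun (\<phi> m)) (ac_of_test_fun (\<phi> n))"
      have "dist (L (\<phi> m)) (L (\<phi> n)) \<le> C * D"
        using C2 by (simp add: dist_norm D_def)
      also have "\<dots> \<le> (\<bar>C\<bar> + 1) * D"
        by (intro mult_right_mono) (auto simp: D_def)
      also have "\<dots> < e"
        using N[OF that] by (simp add: D_def field_simps)
      finally show ?thesis .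
    qed
    then show "\<exists>N. \<forall>m\<ge>N. \<forall>n\<ge>N. dist (L (\<phi> m)) (L (\<phi> n)) < e" by blast
  qed
  then obtain I where I: "(\<lambda>n. L (\<phi> n)) \<longlonglongrightarrow> I"
    using Cauchy_convergent_iff convergent_def by blast
  have "ac_integral f g = I"
  proof (rule ac_integral_eqI)
    fix \<psi> assume \<psi>: "(\<lambda>n. norm (f - ac_of_test_fun (\<psi> n))) \<longlonglongrightarrow> 0"
    have "(\<lambda>n. C * norm (ac_of_test_fun (\<psi> n) - ac_of_test_fun (\<phi> n))) \<longlonglongrightarrow> C * norm (f - f)"
      by (intro tendsto_intros conv \<phi> \<psi>)
    then have "(\<lambda>n. C * norm (ac_of_test_fun (\<psi> n) - ac_of_test_fun (\<phi> n))) \<longlonglongrightarrow> 0" by simp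
    then have "(\<lambda>n. L (\<psi> n) - L (\<phi> n)) \<longlonglongrightarrow> 0"
      by (rule Lim_null_comparison[rotated]) (use C2 in auto)
    from tendsto_add[OF this I] show "(\<lambda>n. LINT x|lebesgue. \<psi> n x * g x) \<longlonglongrightarrow> I"
      by (simp add: L_def)
  qed
  with I show ?thesis by (simp add: L_def)
qed

lemma ac_integral_test_fun:
  assumes "g \<in> EBV"
  shows "ac_integral (ac_of_test_fun \<phi>) g = (LINT x|lebesgue. \<phi> x * g x)"
  using ac_integral_limit[OF assms, of "ac_of_test_fun \<phi>" "\<lambda>n. \<phi>"] by (simp add: LIMSEQ_const_iff)

text \<open>Additivity, homogeneity and the bound \<open>C\<close> all hold on test functions and
  survive the passage to the limit along approximating sequences.\<close>

lemma bounded_linear_ac_integral: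
  assumes g: "g \<in> EBV"
  shows "bounded_linear (\<lambda>f. ac_integral f g)"
proof -
  obtain C where C: "\<And>\<phi>. \<bar>LINT x|lebesgue. apply_test_fun \<phi> x * g x\<bar> \<le> C * norm (ac_of_test_fun \<phi>)"
    using EBV_pairing_bounded[OF g] by blast
  have "locally_integrable g" using g by (simp add: EBV_def)
  note int = integrable_mult_test_fun[OF this, unfolded mult.commute[of "g _"]]
  have conv: "(\<lambda>n. ac_of_test_fun (\<phi> n)) \<longlonglongrightarrow> f \<longleftrightarrow> (\<lambda>n. norm (f - ac_of_test_fun (\<phi> n))) \<longlonglongrightarrow> 0" for \<phi> f
    by (subst norm_minus_commute) (simp only: tendsto_norm_zero_iff LIM_zero_iff)
  have lim: "(\<lambda>n. LINT x|lebesgue. \<phi> n x * g x) \<longlonglongrightarrow> ac_integral f g"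
    if "(\<lambda>n. ac_of_test_fun (\<phi> n)) \<longlonglongrightarrow> f" for \<phi> f
    using ac_integral_limit[OF g] that by (simp only: conv)
  have ex: "\<exists>\<phi>. (\<lambda>n. ac_of_test_fun (\<phi> n)) \<longlonglongrightarrow> f" for f
    unfolding conv by (rule test_fun_sequence) blast
  show ?thesis
  proof (rule bounded_linear_intro[where K = C])
    fix f h :: ac and c :: real
    obtain \<phi> \<psi> where \<phi>: "(\<lambda>n. ac_of_test_fun (\<phi> n)) \<longlonglongrightarrow> f" and \<psi>: "(\<lambda>n. ac_of_test_fun (\<psi> n)) \<longlonglongrightarrow> h"
      using ex by metis
    have "(\<lambda>n. ac_of_test_fun (\<phi> n + \<psi> n)) \<longlonglongrightarrow> f + h"
      unfolding ac_of_test_fun_add by (intro tendsto_intros \<phi> \<psi>)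
    from lim[OF this] have "(\<lambda>n. (LINT x|lebesgue. \<phi> n x * g x) + (LINT x|lebesgue. \<psi> n x * g x)) \<longlonglongrightarrow> ac_integral (f + h) g"
      using int by (simp add: plus_test_fun.rep_eq distrib_right)
    with tendsto_add[OF lim[OF \<phi>] lim[OF \<psi>]] show "ac_integral (f + h) g = ac_integral f g + ac_integral h g"
      using LIMSEQ_unique by blast
    have "(\<lambda>n. ac_of_test_fun (c *\<^sub>R \<phi> n)) \<longlonglongrightarrow> c *\<^sub>R f"
      unfolding ac_of_test_fun_scaleR by (intro tendsto_intros \<phi>)
    from lim[OF this] have "(\<lambda>n. c * (LINT x|lebesgue. \<phi> n x * g x)) \<longlonglongrightarrow> ac_integral (c *\<^sub>R f) g"
      by (simp add: scaleR_test_fun.rep_eq mult.assoc)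
    with tendsto_mult_left[OF lim[OF \<phi>], of c] show "ac_integral (c *\<^sub>R f) g = c *\<^sub>R ac_integral f g"
      using LIMSEQ_unique by fastforce
    have "(\<lambda>n. \<bar>LINT x|lebesgue. \<phi> n x * g x\<bar>) \<longlonglongrightarrow> \<bar>ac_integral f g\<bar>"
      by (intro tendsto_intros lim \<phi>)
    moreover have "(\<lambda>n. C * norm (ac_of_test_fun (\<phi> n))) \<longlonglongrightarrow> C * norm f"
      by (intro tendsto_intros \<phi>)
    ultimately show "norm (ac_integral f g) \<le> norm f * C"
      using C by (auto intro: LIMSEQ_le simp: mult.commute[of _ C])
  qed
qed

section \<open>Functionals as integrals\<close>

text \<open>This lets the primitive of a finite sum or of an \<open>ac\<close>-valued integral be
  computed pointwise.\<close>

lemma bounded_linear_primitive: "bounded_linear (\<lambda>f. primitive f x)"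
  by (rule bounded_linear_intro[where K = 1])
     (use primitive_le_norm[of _ x] in \<open>auto simp: primitive_add primitive_scaleR\<close>)

lemma primitive_sum: "primitive (\<Sum>i\<in>A. f i) x = (\<Sum>i\<in>A. primitive (f i) x)"
  by (rule linear_sum[OF bounded_linear.linear[OF bounded_linear_primitive]])

section \<open>Continuous ramps rising to the unit step\<close>

definition ramp :: "nat \<Rightarrow> real \<Rightarrow> real" where
  "ramp n x = min 1 (max 0 (real (Suc n) * x))"

lemma ramp_bounds: "0 \<le> ramp n x" "ramp n x \<le> 1"
  by (auto simp: ramp_def)

lemma ramp_nonpos: "x \<le> 0 \<Longrightarrow> ramp n x = 0"
  by (simp add: ramp_def mult_nonneg_nonpos del: of_nat_Suc)

lemma ramp_eq_1: "x \<ge> 1 / real (Suc n) \<Longrightarrow> ramp n x = 1"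
  by (simp add: ramp_def field_simps del: of_nat_Suc)

lemma ramp_Suc_ge: "ramp n x \<le> ramp (Suc n) x"
proof (cases "x \<ge> 0")
  case True
  then have "real (Suc n) * x \<le> real (Suc (Suc n)) * x" by (intro mult_right_mono) auto
  then show ?thesis by (auto simp: ramp_def simp del: of_nat_Suc)
qed (simp add: ramp_nonpos)

lemma ramp_lipschitz: "\<bar>ramp n x - ramp n y\<bar> \<le> real (Suc n) * \<bar>x - y\<bar>"
proof -
  have "\<bar>ramp n x - ramp n y\<bar> \<le> \<bar>real (Suc n) * x - real (Suc n) * y\<bar>"
    by (auto simp: ramp_def simp del: of_nat_Suc)
  then show ?thesis
    by (simp add: abs_mult right_diff_distrib[symmetric] del: of_nat_Suc)
qed

lemma continuous_on_ramp [continuous_intros]: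
  "continuous_on A f \<Longrightarrow> continuous_on A (\<lambda>x. ramp n (f x))"
  unfolding ramp_def by (intro continuous_intros)

text \<open>As a function this is the density \<open>n + 1\<close> on an interval of length
  \<open>1 / (n + 1)\<close> to the right of \<open>t\<close>: an approximation of the Dirac measure
  at \<open>t\<close>, which itself has no continuous primitive. The choice is unambiguous because
  elements with equal primitives are equal.\<close>

definition ac_ramp :: "nat \<Rightarrow> real \<Rightarrow> ac" where
  "ac_ramp n t = (SOME f. primitive f = (\<lambda>x. ramp n (x - t)))"

lemma primitive_ac_ramp: "primitive (ac_ramp n t) x = ramp n (x - t)"
proof -
  have "(\<lambda>x. ramp n (x - t)) \<in> BC"
  proof (rule BC_eventually_constant)
    show "continuous_on UNIV (\<lambda>x. ramp n (x - t))"
      by (intro continuous_intros)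
    show "ramp n (x - t) = 0" if "x < - (\<bar>t\<bar> + 1)" for x
      using that by (intro ramp_nonpos) simp
    show "ramp n (x - t) = 1" if "x > \<bar>t\<bar> + 1" for x
    proof (rule ramp_eq_1)
      have "1 / real (Suc n) \<le> 1" by simp
      then show "1 / real (Suc n) \<le> x - t" using that by linarith
    qed
  qed
  then have "\<exists>f. primitive f = (\<lambda>x. ramp n (x - t))"
    by (rule primitive_surj) blast
  from someI_ex[OF this] show ?thesis
    unfolding ac_ramp_def by simp
qed

text \<open>Translating a ramp changes it uniformly by at most its slope times the shift. Continuity
  in \<open>t\<close> guarantees that the \<open>ac\<close>-valued integrals over \<open>t\<close>
  exist.\<close>

lemma continuous_on_ac_ramp: "continuous_on A (ac_ramp n)"
proof (rule continuous_on_subset)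
  have "(real (Suc n))-lipschitz_on UNIV (ac_ramp n)"
  proof (rule lipschitz_onI)
    fix t u
    have "norm (ac_ramp n t - ac_ramp n u) \<le> real (Suc n) * \<bar>t - u\<bar>"
    proof (rule norm_ac_leI)
      show "\<bar>primitive (ac_ramp n t - ac_ramp n u) x\<bar> \<le> real (Suc n) * \<bar>t - u\<bar>" for x
        using ramp_lipschitz[of n "x - t" "x - u"] by (simp add: primitive_diff primitive_ac_ramp abs_minus_commute[of u] del: of_nat_Suc)
    qed
    then show "dist (ac_ramp n t) (ac_ramp n u) \<le> real (Suc n) * dist t u"
      by (simp add: dist_norm)
  qed simp
  then show "continuous_on UNIV (ac_ramp n)"
    by (rule lipschitz_on_continuous_on)
qed simp

text \<open>The ramps increase with \<open>n\<close> and lie between 0 and 1, so every signed sum of their increments has norm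
  at most 1; hence the increments of \<open>\<Lambda>\<close> along the ramps are absolutely summable.\<close>

lemma convergent_functional_ramp:
  fixes \<Lambda> :: "ac \<Rightarrow> real"
  assumes \<Lambda>: "bounded_linear \<Lambda>"
  shows "convergent (\<lambda>n. \<Lambda> (ac_ramp n t))"
proof -
  interpret \<Lambda>: bounded_linear \<Lambda> by (rule \<Lambda>)
  obtain B where B: "B \<ge> 0" "\<And>f. norm (\<Lambda> f) \<le> norm f * B"
    using \<Lambda>.nonneg_bounded by blast
  define d where "d n = ac_ramp (Suc n) t - ac_ramp n t" for n
  have "(\<Sum>k<m. \<bar>\<Lambda> (d k)\<bar>) \<le> B" for m
  proof -
    \<comment> \<open>The signs are chosen so that \<open>\<Lambda> f\<close> is exactly the sum of
      the absolute values.\<close>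
    define f where "f = (\<Sum>k<m. sgn (\<Lambda> (d k)) *\<^sub>R d k)"
    have "norm f \<le> 1"
    proof (rule norm_ac_leI)
      fix x
      have "\<bar>primitive f x\<bar> \<le> (\<Sum>k<m. \<bar>primitive (sgn (\<Lambda> (d k)) *\<^sub>R d k) x\<bar>)"
        unfolding f_def primitive_sum by (rule sum_abs)
      also have "\<dots> \<le> (\<Sum>k<m. ramp (Suc k) (x - t) - ramp k (x - t))"
      proof (rule sum_mono)
        fix k
        have "\<bar>sgn (\<Lambda> (d k))\<bar> \<le> 1" by (simp add: sgn_if)
        then have "\<bar>primitive (sgn (\<Lambda> (d k)) *\<^sub>R d k) x\<bar> \<le> \<bar>primitive (d k) x\<bar>"
          by (simp add: primitive_scaleR abs_mult mult_left_le_one_le)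
        also have "\<dots> = ramp (Suc k) (x - t) - ramp k (x - t)"
          using ramp_Suc_ge[of k "x - t"] by (simp add: d_def primitive_diff primitive_ac_ramp)
        finally show "\<bar>primitive (sgn (\<Lambda> (d k)) *\<^sub>R d k) x\<bar> \<le> ramp (Suc k) (x - t) - ramp k (x - t)" .
      qed
      also have "\<dots> = ramp m (x - t) - ramp 0 (x - t)"
        by (rule sum_lessThan_telescope)
      also have "\<dots> \<le> 1" using ramp_bounds[of m] ramp_bounds[of 0] by (smt (verit))
      finally show "\<bar>primitive f x\<bar> \<le> 1" .
    qed
    have "(\<Sum>k<m. \<bar>\<Lambda> (d k)\<bar>) = \<Lambda> f"
      unfolding f_def by (simp add: \<Lambda>.sum \<Lambda>.scaleR abs_sgn mult.commute)
    also have "\<dots> \<le> norm f * B" using B(2)[of f] by simp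
    also have "\<dots> \<le> B" using \<open>norm f \<le> 1\<close> B(1) by (simp add: mult_left_le_one_le)
    finally show ?thesis .
  qed
  then have "summable (\<lambda>k. norm (\<Lambda> (d k)))"
    by (intro summableI_nonneg_bounded[where x = B]) auto
  then have "summable (\<lambda>k. \<Lambda> (d k))" by (rule summable_norm_cancel)
  then have "convergent (\<lambda>m. \<Lambda> (ac_ramp 0 t) + (\<Sum>k<m. \<Lambda> (d k)))"
    by (intro convergent_add convergent_const) (simp add: summable_iff_convergent)
  moreover have "\<Lambda> (ac_ramp 0 t) + (\<Sum>k<m. \<Lambda> (d k)) = \<Lambda> (ac_ramp m t)" for m
    using sum_lessThan_telescope[of "\<lambda>k. \<Lambda> (ac_ramp k t)" m] by (simp add: d_def \<Lambda>.diff)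
  ultimately show ?thesis by simp
qed

text \<open>A bridge between the Lebesgue integral on the line and the gauge integral on an
  interval, the latter being the one used for integrands with values in \<open>ac\<close>.\<close>

lemma compact_support_integral:
  fixes h :: "real \<Rightarrow> real"
  assumes h: "continuous_on UNIV h" "\<And>x. \<bar>x\<bar> > r \<Longrightarrow> h x = 0"
  shows "integrable lborel h" "(LINT x|lborel. h x) = integral {-r..r} h"
proof -
  have int: "set_integrable lborel {-r..r} h"
    unfolding set_integrable_def by (intro borel_integrable_compact continuous_on_subset[OF h(1)]) auto
  have eq: "indicator {-r..r} x *\<^sub>R h x = h x" for x
    using h(2)[of x] by (cases "\<bar>x\<bar> > r") (auto simp: indicator_def)
  show "integrable lborel h"
    using int by (simp add: set_integrable_def eq del: real_scaleR_def)
  show "(LINT x|lborel. h x) = integral {-r..r} h"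
    using set_borel_integral_eq_integral(2)[OF int] by (simp add: set_lebesgue_integral_def eq del: real_scaleR_def)
qed

text \<open>Against the exact step at \<open>x\<close> the integral would be \<open>F x\<close>. The
  ramp differs from the step, by at most 1, only for \<open>t\<close> in an interval of length
  \<open>1 / (n + 1)\<close>. The bound is uniform in \<open>x\<close>, as norm convergence
  requires.\<close>

lemma integral_ramp_approx:
  fixes \<phi> F :: "real \<Rightarrow> real"
  assumes \<phi>: "continuous_on UNIV \<phi>" "\<And>x. \<bar>x\<bar> > r \<Longrightarrow> \<phi> x = 0" "\<And>x. \<bar>\<phi> x\<bar> \<le> M"
    and F: "\<And>x. (F has_real_derivative \<phi> x) (at x)" "\<And>x. x < - r \<Longrightarrow> F x = 0"
  shows "\<bar>(LINT t|lborel. \<phi> t * ramp n (x - t)) - F x\<bar> \<le> M / real (Suc n)"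
proof -
  have int1: "integrable lborel (\<lambda>t. \<phi> t * ramp n (x - t))"
    by (rule compact_support_integral(1)[of _ r]) (auto intro!: continuous_intros \<phi>)
  \<comment> \<open>To the left of \<open>a\<close> both \<open>F\<close> and \<open>\<phi>\<close>
    vanish, so integrating from \<open>a\<close> to \<open>x\<close> recovers \<open>F x\<close> and
    truncation at \<open>a\<close> loses nothing.\<close>
  define a where "a = - \<bar>r\<bar> - \<bar>x\<bar> - 1"
  have a: "a < - r" "a \<le> x" by (auto simp: a_def)
  have int2: "integrable lborel (\<lambda>t. \<phi> t * indicator {a..x} t)"
    and F_eq: "(LINT t|lborel. \<phi> t * indicator {a..x} t) = F x"
    using integral_FTC_Icc_real[of a x F \<phi>] borel_integrable_compact[of "{a..x}" \<phi>] a F \<phi>(1)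
      continuous_on_subset[OF \<phi>(1), of "{a..x}"]
    by (auto simp: continuous_on_eq_continuous_at mult.commute)
  have int3: "integrable lborel (\<lambda>t. M * indicator {x - 1 / real (Suc n)..x} t)"
    by simp
  have "(LINT t|lborel. \<phi> t * ramp n (x - t)) - F x =
      (LINT t|lborel. \<phi> t * ramp n (x - t) - \<phi> t * indicator {a..x} t)"
    using int1 int2 by (simp add: F_eq)
  also have "\<bar>\<dots>\<bar> \<le> (LINT t|lborel. M * indicator {x - 1 / real (Suc n)..x} t)"
  proof (rule integral_abs_bound_integral[OF _ int3])
    show "integrable lborel (\<lambda>t. \<phi> t * ramp n (x - t) - \<phi> t * indicator {a..x} t)"
      using int1 int2 by simp
    fix t
    have M: "M \<ge> 0" using \<phi>(3)[of 0] by linarith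
    consider "t > x" | "t < x - 1 / real (Suc n)" | "x - 1 / real (Suc n) \<le> t" "t \<le> x" by linarith
    then show "\<bar>\<phi> t * ramp n (x - t) - \<phi> t * indicator {a..x} t\<bar> \<le> M * indicator {x - 1 / real (Suc n)..x} t"
    proof cases
      case 1
      then show ?thesis using M by (simp add: ramp_nonpos)
    next
      case 2
      have "1 / real (Suc n) > 0" by simp
      then have "t \<le> x" using 2 by linarith
      have "\<phi> t = 0" if "t < a" using that a by (intro \<phi>(2)) (auto simp: a_def)
      then show ?thesis using 2 M \<open>t \<le> x\<close> by (cases "t < a") (auto simp: ramp_eq_1 indicator_def)
    next
      case 3
      have "\<bar>ramp n (x - t) - indicator {a..x} t\<bar> \<le> 1"
        using ramp_bounds[of n "x - t"] by (auto simp: indicator_def)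
      then have "\<bar>\<phi> t\<bar> * \<bar>ramp n (x - t) - indicator {a..x} t\<bar> \<le> M * 1"
        using \<phi>(3) by (intro mult_mono) (auto intro: M)
      then show ?thesis using 3 by (simp add: abs_mult right_diff_distrib[symmetric])
    qed
  qed
  also have "\<dots> = M / real (Suc n)" by simp
  finally show ?thesis .
qed

text \<open>The density \<open>g\<close> is the pointwise limit of \<open>\<Lambda>\<close> on the
  ramps. Only continuity of \<open>\<phi>\<close> is demanded, so the formula covers test functions
  as well as derivatives of the \<open>C1\<close> functions that define the essential
  variation.\<close>

lemma functional_representation:
  fixes \<Lambda> :: "ac \<Rightarrow> real"
  assumes \<Lambda>: "bounded_linear \<Lambda>"
  obtains g B where "g \<in> borel_measurable borel" "\<And>t. \<bar>g t\<bar> \<le> B" "\<And>f. \<bar>\<Lambda> f\<bar> \<le> norm f * B"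
    "\<And>f \<phi> r. continuous_on UNIV \<phi> \<Longrightarrow> (\<And>x. \<bar>x\<bar> > r \<Longrightarrow> \<phi> x = 0) \<Longrightarrow>
      (\<And>x. (primitive f has_real_derivative \<phi> x) (at x)) \<Longrightarrow> (\<And>x. x < - r \<Longrightarrow> primitive f x = 0) \<Longrightarrow>
      \<Lambda> f = (LINT t|lebesgue. \<phi> t * g t)"
proof -
  interpret \<Lambda>: bounded_linear \<Lambda> by (rule \<Lambda>)
  obtain B where B: "B \<ge> 0" "\<And>f. norm (\<Lambda> f) \<le> norm f * B"
    using \<Lambda>.nonneg_bounded by blast
  define G where "G n t = \<Lambda> (ac_ramp n t)" for n t
  define g where "g t = lim (\<lambda>n. G n t)" for t
  have lim: "(\<lambda>n. G n t) \<longlonglongrightarrow> g t" for t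
    using convergent_functional_ramp[OF \<Lambda>] unfolding G_def g_def by (simp add: convergent_LIMSEQ_iff)
  have contG: "continuous_on UNIV (G n)" for n
    unfolding G_def by (rule bounded_linear.continuous_on[OF \<Lambda> continuous_on_ac_ramp])
  then have G_meas [measurable]: "G n \<in> borel_measurable borel" for n
    by (rule borel_measurable_continuous_onI)
  have g_meas [measurable]: "g \<in> borel_measurable borel"
    by (rule borel_measurable_LIMSEQ_real[OF lim G_meas])
  have GB: "\<bar>G n t\<bar> \<le> B" for n t
  proof -
    have "norm (ac_ramp n t) \<le> 1"
      by (rule norm_ac_leI) (use ramp_bounds in \<open>simp add: primitive_ac_ramp\<close>)
    then have "norm (ac_ramp n t) * B \<le> B" using B(1) by (simp add: mult_left_le_one_le)
    then show ?thesis using B(2)[of "ac_ramp n t"] by (simp add: G_def)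
  qed
  have gB: "\<bar>g t\<bar> \<le> B" for t
    by (rule LIMSEQ_le_const2[OF tendsto_rabs[OF lim]]) (use GB in auto)
  have "\<Lambda> f = (LINT t|lebesgue. \<phi> t * g t)"
    if \<phi>: "continuous_on UNIV \<phi>" "\<And>x. \<bar>x\<bar> > r \<Longrightarrow> \<phi> x = 0"
      and F: "\<And>x. (primitive f has_real_derivative \<phi> x) (at x)" "\<And>x. x < - r \<Longrightarrow> primitive f x = 0"
    for f \<phi> r
  proof -
    obtain M where M: "\<And>x. \<bar>\<phi> x\<bar> \<le> M"
      using bounded_compact_support[OF \<phi>] by blast
    \<comment> \<open>The primitive of \<open>I n\<close> at \<open>x\<close> is the integral of
      \<open>\<phi> t * ramp n (x - t)\<close>, so \<open>I n\<close> approximates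
      \<open>f\<close>.\<close>
    define I where "I n = integral {-r..r} (\<lambda>t. \<phi> t *\<^sub>R ac_ramp n t)" for n
    have int: "(\<lambda>t. \<phi> t *\<^sub>R ac_ramp n t) integrable_on {-r..r}" for n
      by (intro integrable_continuous_interval continuous_intros continuous_on_ac_ramp
          continuous_on_subset[OF \<phi>(1)]) auto
    \<comment> \<open>Used for two functionals: evaluation of the primitive at a point, which gives
      \<open>I n\<close> tending to \<open>f\<close>, and \<open>\<Lambda>\<close> itself.\<close>
    have bl: "T (I n) = (LINT t|lborel. \<phi> t * T (ac_ramp n t))"
      if T: "bounded_linear T" for T :: "ac \<Rightarrow> real" and n
    proof -
      have "T (I n) = integral {-r..r} (\<lambda>t. \<phi> t * T (ac_ramp n t))"
        using integral_linear[OF int T] linear_scale[OF bounded_linear.linear[OF T]]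
        by (simp add: I_def o_def)
      also have "\<dots> = (LINT t|lborel. \<phi> t * T (ac_ramp n t))"
        by (rule compact_support_integral(2)[symmetric])
           (auto intro!: continuous_intros \<phi> bounded_linear.continuous_on[OF T] continuous_on_ac_ramp)
      finally show ?thesis .
    qed
    have "norm (I n - f) \<le> M / real (Suc n)" for n
    proof (rule norm_ac_leI)
      show "\<bar>primitive (I n - f) x\<bar> \<le> M / real (Suc n)" for x
        using integral_ramp_approx[where x = x and n = n, OF \<phi> M F] bl[OF bounded_linear_primitive[of x], of n]
        by (simp add: primitive_diff primitive_ac_ramp del: of_nat_Suc)
    qed
    moreover have "(\<lambda>n. M / real (Suc n)) \<longlonglongrightarrow> 0"
      by (rule LIMSEQ_Suc[OF lim_const_over_n])
    ultimately have "(\<lambda>n. I n - f) \<longlonglongrightarrow> 0"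
      by (rule Lim_null_comparison[OF always_eventually[OF allI]])
    then have "I \<longlonglongrightarrow> f" by (simp add: LIM_zero_iff)
    from \<Lambda>.tendsto[OF this] have "(\<lambda>n. LINT t|lborel. \<phi> t * G n t) \<longlonglongrightarrow> \<Lambda> f"
      by (simp add: bl[OF \<Lambda>] G_def)
    moreover have "(\<lambda>n. LINT t|lborel. \<phi> t * G n t) \<longlonglongrightarrow> (LINT t|lborel. \<phi> t * g t)"
    proof (rule integral_dominated_convergence)
      have [measurable]: "\<phi> \<in> borel_measurable borel"
        using \<phi>(1) by (rule borel_measurable_continuous_onI)
      show "(\<lambda>t. \<phi> t * g t) \<in> borel_measurable lborel"
        "(\<lambda>t. \<phi> t * G n t) \<in> borel_measurable lborel" for n
        by measurable
      show "integrable lborel (\<lambda>t. \<bar>\<phi> t\<bar> * B)"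
        using compact_support_integral(1)[OF \<phi>] by simp
      show "AE t in lborel. (\<lambda>n. \<phi> t * G n t) \<longlonglongrightarrow> \<phi> t * g t"
        by (intro AE_I2 tendsto_intros lim)
      show "AE t in lborel. norm (\<phi> t * G n t) \<le> \<bar>\<phi> t\<bar> * B" for n
        by (intro AE_I2) (simp add: abs_mult mult_left_mono GB)
    qed
    ultimately have "\<Lambda> f = (LINT t|lborel. \<phi> t * g t)"
      by (rule LIMSEQ_unique)
    also have "\<dots> = (LINT t|lebesgue. \<phi> t * g t)"
      using borel_measurable_continuous_onI[OF \<phi>(1)] g_meas
      by (intro integral_completion[symmetric]) simp
    finally show ?thesis .
  qed
  note rep = this
  show thesis
    by (rule that[OF g_meas gB _ rep]) (use B(2) in auto)
qed

section \<open>Uniqueness and the dual space\<close>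

text \<open>The positive and negative parts of \<open>f\<close> are densities of two measures that
  agree and are finite on the half-lines, hence are equal. Uniqueness of densities then makes the
  two parts equal almost everywhere.\<close>

lemma AE_zero_if_integrals_Ioi_zero:
  fixes f :: "real \<Rightarrow> real"
  assumes f: "integrable lborel f" and zero: "\<And>a. (LINT x|lborel. f x * indicator {a<..} x) = 0"
  shows "AE x in lborel. f x = 0"
proof -
  have [measurable]: "f \<in> borel_measurable borel"
    using borel_measurable_integrable[OF f] by simp
  let ?p = "\<lambda>x. ennreal (f x)" and ?q = "\<lambda>x. ennreal (- f x)"
  have eq: "emeasure (density lborel ?p) {a<..} = emeasure (density lborel ?q) {a<..}"
    and fin: "emeasure (density lborel ?p) {a<..} < \<infinity>" for a
  proof -
    define h where "h x = f x * indicator {a<..} x" for x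
    have h: "integrable lborel h"
      using integrable_mult_indicator[OF _ f, of "{a<..}"] by (simp add: h_def[abs_def] mult.commute)
    have p: "emeasure (density lborel ?p) {a<..} = (\<integral>\<^sup>+ x. ennreal (h x) \<partial>lborel)"
      by (auto simp: emeasure_density h_def indicator_def intro!: nn_integral_cong)
    have q: "emeasure (density lborel ?q) {a<..} = (\<integral>\<^sup>+ x. ennreal (- h x) \<partial>lborel)"
      by (auto simp: emeasure_density h_def indicator_def intro!: nn_integral_cong)
    have hfin: "(\<integral>\<^sup>+ x. ennreal (h x) \<partial>lborel) \<noteq> \<infinity>" "(\<integral>\<^sup>+ x. ennreal (- h x) \<partial>lborel) \<noteq> \<infinity>"
      using h by (simp_all add: real_integrable_def)
    have "enn2real (\<integral>\<^sup>+ x. ennreal (h x) \<partial>lborel) = enn2real (\<integral>\<^sup>+ x. ennreal (- h x) \<partial>lborel)"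
      using real_lebesgue_integral_def[OF h] zero[of a] by (simp add: h_def[abs_def])
    then have "(\<integral>\<^sup>+ x. ennreal (h x) \<partial>lborel) = (\<integral>\<^sup>+ x. ennreal (- h x) \<partial>lborel)"
      using hfin by (metis ennreal_enn2real infinity_ennreal_def less_top)
    then show "emeasure (density lborel ?p) {a<..} = emeasure (density lborel ?q) {a<..}"
      by (simp only: p q)
    show "emeasure (density lborel ?p) {a<..} < \<infinity>"
      using hfin(1) by (simp only: p less_top infinity_ennreal_def)
  qed
  have "density lborel ?p = density lborel ?q"
    by (rule measure_eqI_lessThan) (use eq fin in auto)
  then have "AE x in lborel. ?p x = ?q x"
    by (rule sigma_finite_measure.density_unique[OF sigma_finite_lborel, rotated 2]) auto
  then show ?thesis
    \<comment> \<open>As \<open>ennreal\<close> sends negative numbers to 0, one of the two equal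
      parts is zero at each point, hence both are.\<close>
    by eventually_elim (metis ennreal_eq_0_iff linorder_linear neg_le_0_iff_le order_antisym)
qed

text \<open>Indicators of open intervals are bounded pointwise limits of test functions supported in
  the closed interval, so dominated convergence carries the vanishing over.\<close>

lemma integral_interval_zero:
  assumes k: "locally_integrable k" and zero: "\<And>\<phi>. (LINT x|lebesgue. k x * apply_test_fun \<phi> x) = 0"
  shows "(LINT x|lebesgue. k x * indicator {a<..<b} x) = 0"
proof -
  obtain \<sigma> where \<sigma>: "smooth \<sigma>" "\<And>x. x \<le> 0 \<Longrightarrow> \<sigma> x = 0" "\<And>x. x \<ge> 1 \<Longrightarrow> \<sigma> x = 1"
    "\<And>x. 0 \<le> \<sigma> x" "\<And>x. \<sigma> x \<le> 1"
    using smooth_step_exists by blast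
  \<comment> \<open>For positive \<open>n\<close> the first factor rises from 0 at \<open>a\<close>
    to 1 at \<open>a + 1 / n\<close>, and the second falls from 1 at \<open>b - 1 / n\<close> to 0
    at \<open>b\<close>. Both transitions start at the endpoints and go inwards, which is why the
    limit is the open interval.\<close>
  define \<phi> where "\<phi> n x = \<sigma> (- real n * a + real n * x) * \<sigma> (real n * b + (- real n) * x)" for n x
  have \<phi>_out: "\<phi> n x = 0" if "x \<notin> {a<..<b}" for n x
  proof -
    have "real n * x \<le> real n * a \<or> real n * b \<le> real n * x"
      using that by (auto simp: not_less intro!: mult_left_mono)
    then show ?thesis by (auto simp: \<phi>_def \<sigma>(2))
  qed
  have \<phi>_bd: "\<bar>\<phi> n x\<bar> \<le> 1" for n x
    using \<sigma>(4,5) by (simp add: \<phi>_def abs_mult mult_le_one)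
  have sm: "smooth (\<phi> n)" for n
    unfolding \<phi>_def by (intro smooth_mult smooth_affine \<sigma>)
  have supp: "compact (closure {x. \<phi> n x \<noteq> 0})" for n
    unfolding compact_support_iff by (rule exI[of _ "max \<bar>a\<bar> \<bar>b\<bar>"]) (auto intro!: \<phi>_out)
  have "apply_test_fun (Abs_test_fun (\<phi> n)) = \<phi> n" for n
    using sm supp by (simp add: Abs_test_fun_inverse del: compact_closure)
  then have zero\<phi>: "(LINT x|lebesgue. k x * \<phi> n x) = 0" for n
    using zero[of "Abs_test_fun (\<phi> n)"] by simp
  have int: "integrable lebesgue (\<lambda>x. indicator {a..b} x * k x)"
    using k by (simp add: locally_integrable_def set_integrable_def)
  have meas: "(\<lambda>x. indicator {a..b} x * k x) \<in> borel_measurable lebesgue"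
    using int by (rule borel_measurable_integrable)
  have "(\<lambda>n. LINT x|lebesgue. k x * \<phi> n x) \<longlonglongrightarrow> (LINT x|lebesgue. k x * indicator {a<..<b} x)"
  proof (rule integral_dominated_convergence)
    show "integrable lebesgue (\<lambda>x. \<bar>indicator {a..b} x * k x\<bar>)"
      using int by (rule integrable_abs)
    show "(\<lambda>x. k x * \<phi> n x) \<in> borel_measurable lebesgue" for n
    proof -
      have "k x * \<phi> n x = (indicator {a..b} x * k x) * \<phi> n x" for x
        using \<phi>_out[of x n] by (cases "x \<in> {a<..<b}") (auto simp: indicator_def)
      then have "(\<lambda>x. k x * \<phi> n x) = (\<lambda>x. (indicator {a..b} x * k x) * \<phi> n x)"
        by (rule ext)
      then show ?thesis
        using borel_measurable_times[OF meas borel_measurable_lebesgue_continuous[OF smooth_continuous[OF sm]]]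
        by (simp only:)
    qed
    have "(\<lambda>x. k x * indicator {a<..<b} x) = (\<lambda>x. (indicator {a..b} x * k x) * indicator {a<..<b} x)"
      by (rule ext) (simp add: indicator_def)
    moreover have "(indicator {a<..<b} :: real \<Rightarrow> real) \<in> borel_measurable lebesgue"
      by (intro measurable_completion) simp
    ultimately show "(\<lambda>x. k x * indicator {a<..<b} x) \<in> borel_measurable lebesgue"
      using borel_measurable_times[OF meas, of "indicator {a<..<b}"] by (simp only:)
    have "(\<lambda>n. \<phi> n x) \<longlonglongrightarrow> indicator {a<..<b} x" for x
    proof (cases "x \<in> {a<..<b}")
      case True
      obtain N :: nat where "max (1 / (x - a)) (1 / (b - x)) \<le> real N"
        using real_arch_simple by blast
      then have N: "1 / (x - a) \<le> real n" "1 / (b - x) \<le> real n" if "n \<ge> N" for n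
        using that of_nat_mono[OF that, where 'a = real] by auto
      have "\<phi> n x = 1" if "n \<ge> N" for n
        using N[OF that] True by (simp add: \<phi>_def \<sigma>(3) field_simps)
      then have "\<forall>\<^sub>F n in sequentially. \<phi> n x = 1"
        using eventually_sequentially by blast
      then show ?thesis using True by (simp add: tendsto_eventually)
    qed (simp add: \<phi>_out)
    then show "AE x in lebesgue. (\<lambda>n. k x * \<phi> n x) \<longlonglongrightarrow> k x * indicator {a<..<b} x"
      by (intro AE_I2 tendsto_intros)
    have "\<bar>k x * \<phi> n x\<bar> \<le> \<bar>indicator {a..b} x * k x\<bar>" for n x
      using \<phi>_bd[of n x] \<phi>_out[of x n] by (cases "x \<in> {a<..<b}") (auto simp: abs_mult mult_left_le)
    then show "AE x in lebesgue. norm (k x * \<phi> n x) \<le> \<bar>indicator {a..b} x * k x\<bar>" for n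
      by (intro AE_I2) simp
  qed
  then show ?thesis by (simp add: zero\<phi> LIMSEQ_const_iff)
qed

text \<open>The fundamental lemma of the calculus of variations. On a bounded interval
  \<open>k\<close> is integrable, and half-line integrals of its truncation are integrals of
  \<open>k\<close> over open intervals; countably many such intervals cover the line.\<close>

lemma AE_zero_if_test_fun_integrals_zero:
  assumes k: "locally_integrable k" and zero: "\<And>\<phi>. (LINT x|lebesgue. k x * apply_test_fun \<phi> x) = 0"
  shows "AE x in lebesgue. k x = 0"
proof -
  have "AE x in lebesgue. x \<in> {- real N<..<real N} \<longrightarrow> k x = 0" for N
  proof -
    let ?J = "{- real N<..<real N}"
    define f where "f x = k x * indicator ?J x" for x
    have f: "integrable lebesgue f"
    proof -
      have "set_integrable lebesgue {- real N..real N} k"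
        using k by (simp add: locally_integrable_def)
      then have "set_integrable lebesgue ?J k"
        by (rule set_integrable_subset) auto
      then show ?thesis by (simp add: set_integrable_def f_def[abs_def] mult.commute)
    qed
    \<comment> \<open>A Borel representative is needed because the half-line criterion concerns
      \<open>lborel\<close>, whereas \<open>k\<close> is only Lebesgue measurable.\<close>
    obtain f' where f': "f' \<in> borel_measurable lborel" "AE x in lborel. f x = f' x"
      using completion_ex_borel_measurable_real[OF borel_measurable_integrable[OF f]] by blast
    have AE: "AE x in lebesgue. f x = f' x"
      using f'(2) by (rule AE_completion)
    have f'_leb: "f' \<in> borel_measurable lebesgue"
      using f'(1) by (rule measurable_completion)
    have "integrable lebesgue f'"
      using f f'_leb AE by (subst integrable_cong_AE[of f' _ f]) auto
    then have int: "integrable lborel f'"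
      using f'(1) by (simp add: integrable_completion)
    have "AE x in lborel. f' x = 0"
    proof (rule AE_zero_if_integrals_Ioi_zero[OF int])
      fix a
      have ind: "(indicator {a<..} :: real \<Rightarrow> real) \<in> borel_measurable lborel" by simp
      have "(LINT x|lborel. f' x * indicator {a<..} x) = (LINT x|lebesgue. f' x * indicator {a<..} x)"
        by (rule integral_completion[symmetric]) (intro borel_measurable_times f' ind)
      also have "\<dots> = (LINT x|lebesgue. f x * indicator {a<..} x)"
        by (rule integral_cong_AE)
           (use AE in \<open>auto intro!: borel_measurable_times f'_leb borel_measurable_integrable[OF f] measurable_completion[OF ind]\<close>)
      also have "\<dots> = (LINT x|lebesgue. k x * indicator {max a (- real N)<..<real N} x)"
        by (intro Bochner_Integration.integral_cong) (auto simp: f_def indicator_def)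
      also have "\<dots> = 0" by (rule integral_interval_zero[OF k zero])
      finally show "(LINT x|lborel. f' x * indicator {a<..} x) = 0" .
    qed
    then have "AE x in lebesgue. f' x = 0" by (rule AE_completion)
    with AE show ?thesis by eventually_elim (auto simp: f_def)
  qed
  then have "AE x in lebesgue. \<forall>N. x \<in> {- real N<..<real N} \<longrightarrow> k x = 0"
    unfolding AE_all_countable by blast
  then show ?thesis
  proof eventually_elim
    case (elim x)
    obtain N :: nat where "\<bar>x\<bar> < real N" using reals_Archimedean2 by blast
    then show ?case using elim by (auto simp: abs_less_iff)
  qed
qed

text \<open>The represented density has essential variation at most \<open>B\<close>, and
  \<open>\<Lambda>\<close> agrees with integration against it on test functions; continuity of
  \<open>\<Lambda>\<close> extends the agreement to all of \<open>ac\<close>.\<close>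

lemma dual_of_ac:
  fixes \<Lambda> :: "ac \<Rightarrow> real"
  assumes \<Lambda>: "bounded_linear \<Lambda>"
  shows "\<exists>g\<in>EBV. \<forall>f. \<Lambda> f = ac_integral f g"
proof -
  interpret \<Lambda>: bounded_linear \<Lambda> by (rule \<Lambda>)
  obtain g B where g: "g \<in> borel_measurable borel" "\<And>t. \<bar>g t\<bar> \<le> B" and B: "\<And>f. \<bar>\<Lambda> f\<bar> \<le> norm f * B"
    and rep: "\<And>f \<phi> r. continuous_on UNIV \<phi> \<Longrightarrow> (\<And>x. \<bar>x\<bar> > r \<Longrightarrow> \<phi> x = 0) \<Longrightarrow>
      (\<And>x. (primitive f has_real_derivative \<phi> x) (at x)) \<Longrightarrow> (\<And>x. x < - r \<Longrightarrow> primitive f x = 0) \<Longrightarrow>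
      \<Lambda> f = (LINT t|lebesgue. \<phi> t * g t)"
    using functional_representation[OF \<Lambda>] by blast
  have "B \<ge> 0" using g(2)[of 0] by linarith
  have "set_integrable lebesgue K g" if K: "compact K" for K
  proof -
    have "set_integrable lebesgue K (\<lambda>x. B)"
      using locally_integrable_continuous[OF continuous_on_const[of UNIV B]] K
      by (simp add: locally_integrable_def)
    moreover have "g \<in> borel_measurable lebesgue"
      using g(1) by (intro measurable_completion) simp
    moreover have "K \<in> sets lebesgue"
      using K by (intro sets_completionI_sets) (simp add: borel_compact)
    ultimately show ?thesis
      unfolding set_integrable_def
      by (elim Bochner_Integration.integrable_bound)
         (use g(2) \<open>B \<ge> 0\<close> in \<open>auto intro!: AE_I2 borel_measurable_scaleR mult_left_mono simp: abs_mult\<close>)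
  qed
  then have lg: "locally_integrable g" by (simp add: locally_integrable_def)
  have "essvar g \<le> ereal B"
    unfolding essvar_def
  proof (rule SUP_least, clarify)
    fix \<phi> :: "real \<Rightarrow> real"
    assume \<phi>: "\<phi> C1_differentiable_on UNIV" "compact (closure {x. \<phi> x \<noteq> 0})" "\<forall>x. \<bar>\<phi> x\<bar> \<le> 1"
    obtain D where D: "\<And>x. (\<phi> has_real_derivative D x) (at x)" "continuous_on UNIV D"
      using \<phi>(1) unfolding C1_differentiable_on_def has_real_derivative_iff_has_vector_derivative by blast
    then have deriv: "deriv \<phi> = D" by (auto intro: DERIV_imp_deriv)
    obtain r where r: "\<And>x. \<bar>x\<bar> > r \<Longrightarrow> \<phi> x = 0"
      using \<phi>(2) unfolding compact_support_iff by blast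
    have rD: "D x = 0" if "\<bar>x\<bar> > r" for x
      by (rule DERIV_unique[OF D(1) DERIV_locally_zero[of "{x. \<bar>x\<bar> > r}"]])
         (use that r in \<open>auto intro!: open_Collect_less continuous_intros\<close>)
    have "continuous_on UNIV \<phi>"
      using D(1) by (meson DERIV_continuous_on has_field_derivative_at_within)
    then have "\<phi> \<in> BC"
      by (rule BC_eventually_constant[of _ r 0]) (auto intro!: r)
    \<comment> \<open>The admissible function \<open>\<phi>\<close> is itself taken as a primitive,
      so the integral of \<open>g\<close> against its derivative is a value of
      \<open>\<Lambda>\<close> on the unit ball.\<close>
    then obtain f where f: "primitive f = \<phi>" by (rule primitive_surj)
    have "\<Lambda> f = (LINT t|lebesgue. D t * g t)"
      by (rule rep[of D r]) (auto simp: f D rD r)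
    moreover have "norm f \<le> 1" by (rule norm_ac_leI) (use \<phi>(3) f in simp)
    then have "norm f * B \<le> B" using \<open>B \<ge> 0\<close> by (simp add: mult_left_le_one_le)
    ultimately show "ereal (LINT x|lebesgue. g x * deriv \<phi> x) \<le> ereal B"
      using B[of f] by (simp add: deriv mult.commute)
  qed
  then have "g \<in> EBV"
    using lg by (auto simp: EBV_def intro: le_less_trans)
  moreover have \<Lambda>_test: "\<Lambda> (ac_of_test_fun \<phi>) = (LINT x|lebesgue. \<phi> x * g x)" for \<phi> :: test_fun
  proof -
    obtain r where r: "\<And>x. \<bar>x\<bar> > r \<Longrightarrow> \<phi> x = 0"
      using test_fun_support by blast
    obtain F c where F: "\<And>x. (F has_real_derivative \<phi> x) (at x)"
        "\<And>x. x < - r \<Longrightarrow> F x = 0" "\<And>x. x > r \<Longrightarrow> F x = c"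
      using antiderivative_compact_support[OF test_fun_continuous r] by blast
    have "F \<in> BC"
      by (rule BC_eventually_constant[OF smooth_continuous[OF smoothI[OF F(1) test_fun_smooth]] F(2,3)])
    then have "primitive (ac_of_test_fun \<phi>) = F"
      using F(1) by (rule primitive_ac_of_test_fun)
    then show ?thesis
      by (intro rep[of _ r]) (auto simp: F r test_fun_continuous)
  qed
  have "\<Lambda> f = ac_integral f g" for f
  proof (rule ac_integral_eqI[symmetric])
    fix \<phi> assume \<phi>: "(\<lambda>n. norm (f - ac_of_test_fun (\<phi> n))) \<longlonglongrightarrow> 0"
    then have "(\<lambda>n. ac_of_test_fun (\<phi> n)) \<longlonglongrightarrow> f"
      by (simp add: norm_minus_commute[of f] tendsto_norm_zero_iff LIM_zero_iff)
    from \<Lambda>.tendsto[OF this] show "(\<lambda>n. LINT x|lebesgue. \<phi> n x * g x) \<longlonglongrightarrow> \<Lambda> f"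
      by (simp add: \<Lambda>_test)
  qed
  ultimately show ?thesis by blast
qed

text \<open>One direction evaluates both functionals on test functions and applies the fundamental
  lemma to \<open>h x - g x\<close>; in the other, \<open>ac_integral\<close> depends on its second
  argument only through integrals against test functions.\<close>

lemma ac_integral_unique:
  assumes g: "g \<in> EBV" and h: "h \<in> EBV"
  shows "(\<forall>f. ac_integral f g = ac_integral f h) \<longleftrightarrow> (AE x in lebesgue. h x = g x)"
proof
  have lg: "locally_integrable g" and lh: "locally_integrable h"
    using g h by (simp_all add: EBV_def)
  {
    assume eq: "\<forall>f. ac_integral f g = ac_integral f h"
    have "AE x in lebesgue. h x - g x = 0"
    proof (rule AE_zero_if_test_fun_integrals_zero)
      show "locally_integrable (\<lambda>x. h x - g x)"
        using lg lh by (auto simp: locally_integrable_def)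
      show "(LINT x|lebesgue. (h x - g x) * \<phi> x) = 0" for \<phi> :: test_fun
        using eq ac_integral_test_fun[OF g, of \<phi>] ac_integral_test_fun[OF h, of \<phi>]
          integrable_mult_test_fun[OF lg, of \<phi>] integrable_mult_test_fun[OF lh, of \<phi>]
        by (simp add: left_diff_distrib mult.commute[of "\<phi> _"])
    qed
    then show "AE x in lebesgue. h x = g x" by simp
  }
  assume AE: "AE x in lebesgue. h x = g x"
  have "(LINT x|lebesgue. \<phi> x * g x) = (LINT x|lebesgue. \<phi> x * h x)" for \<phi> :: test_fun
  proof (rule integral_cong_AE)
    show "(\<lambda>x. \<phi> x * g x) \<in> borel_measurable lebesgue" "(\<lambda>x. \<phi> x * h x) \<in> borel_measurable lebesgue"
      using integrable_mult_test_fun[OF lg, of \<phi>] integrable_mult_test_fun[OF lh, of \<phi>]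
      by (auto simp: mult.commute dest: borel_measurable_integrable)
    show "AE x in lebesgue. \<phi> x * g x = \<phi> x * h x"
      using AE by eventually_elim simp
  qed
  then show "\<forall>f. ac_integral f g = ac_integral f h"
    by (simp add: ac_integral_def)
qed

theorem corollary9:
  shows "(\<forall>g\<in>EBV. bounded_linear (\<lambda>f. ac_integral f g)) \<and>
    (\<forall>\<Lambda> :: ac \<Rightarrow> real. bounded_linear \<Lambda> \<longrightarrow>
      (\<exists>g\<in>EBV. (\<forall>f. \<Lambda> f = ac_integral f g) \<and>
        (\<forall>h\<in>EBV. (\<forall>f. \<Lambda> f = ac_integral f h) \<longleftrightarrow> (AE x in lebesgue. h x = g x))))"
proof (intro conjI ballI allI impI)
  fix \<Lambda> :: "ac \<Rightarrow> real" assume "bounded_linear \<Lambda>"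
  then obtain g where g: "g \<in> EBV" "\<And>f. \<Lambda> f = ac_integral f g"
    using dual_of_ac by blast
  then show "\<exists>g\<in>EBV. (\<forall>f. \<Lambda> f = ac_integral f g) \<and>
      (\<forall>h\<in>EBV. (\<forall>f. \<Lambda> f = ac_integral f h) \<longleftrightarrow> (AE x in lebesgue. h x = g x))"
    using ac_integral_unique[OF g(1)] by auto
qed (rule bounded_linear_ac_integral)

end
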